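(* Let $\mathcal{R}\subset I\times J$ be a relation between finite sets whose maxbiclique lattice (with $J$ as the lower part) is flag connected, of rank $d+1$, and diamond. Then $\mathcal{R}$ has a filled $1$-incidence matrix of rank $d$ if and only if $\mathcal{R}$ has a filled $0$-incidence matrix of rank $d+1$. Moreover, for such $\mathcal{R}$, a real $I\times J$ matrix $N$ is a facet-ray matrix of some type $\mathcal{R}$ cone in $\mathbb{R}^{d+1}$ if and only if $N$ is a rank $d+1$ filled $0$-incidence matrix of $\mathcal{R}$; and such matrices $N$, modulo multiplication of rows and columns by positive scalars (i.e. $N\sim D_1ND_2$ with $D_1,D_2$ positive diagonal), parameterize the projective moduli space of type $\mathcal{R}$ polytopes (realizations in $\mathbb{R}^d$ modulo projective transformations), a polytope $P$ corresponding to the class of a facet-ray matrix of its homogenization cone $\{t(x,1): t\ge 0, x\in P\}\subset\mathbb{R}^{d+1}$.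
   Context: A filled $x$-incidence matrix of $\mathcal{R}$ is a real $I\times J$ matrix $M$ with $[M]_{i,j}=x$ for $(i,j)\in\mathcal{R}$ and $[M]_{i,j}<x$ otherwise. An induced biclique is a pair $(I_0,J_0)$, $I_0\subset I$, $J_0\subset J$, with $I_0\times J_0\subset\mathcal{R}$; a maxbiclique is an inclusion-maximal one; the maxbiclique lattice is the set of maxbicliques ordered by $(I_0,J_0)\le(I_1,J_1)$ iff $J_0\subset J_1$. A flag is a maximal chain; a poset is graded if all flags have the same length, its rank being that length (a singleton has rank $0$). The flag graph has a node per flag and edges between flags differing in exactly one element; flag connected means graded with connected flag graph. Diamond means graded with every interval $[a,b]$, $\mathrm{rank}(b)=\mathrm{rank}(a)+2$, having exactly 4 elements. A cone is the set of nonnegative linear combinations of finitely many vectors in $\mathbb{R}^{d+1}$ containing no line. Generators are a minimal set of vectors whose nonnegative combinations give the cone; cogenerators are generators of the polar cone $C^*=\{y:\langle y,x\rangle\le 0\ \forall x\in C\}$. For a full-dimensional cone $C$ with generators $w_j$ and cogenerators $h_i$ (so $C=\{x:\langle h_i,x\rangle\le 0\ \forall i\}$), a facet-ray matrix is $[N]_{i,j}=\langle h_i,w_j\rangle$ (defined up to positive scaling of rows and columns). A type $\mathcal{R}$ cone has facets indexed by $I$, extreme rays indexed by $J$, with facet $i$ containing ray $j$ iff $(i,j)\in\mathcal{R}$; a type $\mathcal{R}$ polytope likewise has facets $I$, vertices $J$ and facet-vertex incidence $\mathcal{R}$.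
   Formalization: Added: no index of I or J is related to every index of the other side; for cones and polytopes, also row sets (and column sets) of R are pairwise incomparable. Without these the claim fails. For d = 0 the moduli claim is stated as: there is exactly one matrix class. *)

theory Defs
  imports "HOL-Analysis.Analysis"
begin

section \<open>Flags of a poset\<close>

text \<open>A poset is given by a carrier and a (reflexive) order relation; the length of a chain
  is its number of elements minus one.\<close>

definition flags :: "'a set \<Rightarrow> ('a \<Rightarrow> 'a \<Rightarrow> bool) \<Rightarrow> 'a set set" where
  "flags A le = {C. pred_on.maxchain A le C}"

definition graded :: "'a set \<Rightarrow> ('a \<Rightarrow> 'a \<Rightarrow> bool) \<Rightarrow> bool" where
  "graded A le \<longleftrightarrow> (\<exists>r. \<forall>C\<in>flags A le. card C = Suc r)"

definition poset_rank :: "'a set \<Rightarrow> ('a \<Rightarrow> 'a \<Rightarrow> bool) \<Rightarrow> nat" where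
  "poset_rank A le = (THE r. \<forall>C\<in>flags A le. card C = Suc r)"

definition element_rank :: "'a set \<Rightarrow> ('a \<Rightarrow> 'a \<Rightarrow> bool) \<Rightarrow> 'a \<Rightarrow> nat" where
  "element_rank A le a = poset_rank {x \<in> A. le x a} le"

definition flag_adjacent :: "'a set \<Rightarrow> ('a \<Rightarrow> 'a \<Rightarrow> bool) \<Rightarrow> ('a set \<times> 'a set) set" where
  "flag_adjacent A le =
     {(C, D). C \<in> flags A le \<and> D \<in> flags A le \<and> card (C - D) = 1 \<and> card (D - C) = 1}"

definition flag_connected :: "'a set \<Rightarrow> ('a \<Rightarrow> 'a \<Rightarrow> bool) \<Rightarrow> bool" where
  "flag_connected A le \<longleftrightarrow>
     graded A le \<and> (\<forall>C\<in>flags A le. \<forall>D\<in>flags A le. (C, D) \<in> (flag_adjacent A le)\<^sup>*)"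

definition diamond :: "'a set \<Rightarrow> ('a \<Rightarrow> 'a \<Rightarrow> bool) \<Rightarrow> bool" where
  "diamond A le \<longleftrightarrow>
     graded A le \<and>
     (\<forall>a\<in>A. \<forall>b\<in>A. le a b \<and> element_rank A le b = element_rank A le a + 2
        \<longrightarrow> card {x \<in> A. le a x \<and> le x b} = 4)"


section \<open>Relations and incidence matrices\<close>

text \<open>The finite index sets of a relation are the types \<open>'i\<close> and \<open>'j\<close>.  Nothing is lost by types being
  nonempty: over an empty index set the maxbiclique lattice is a singleton, of rank \<open>0\<close>.\<close>

definition biclique :: "('i \<times> 'j) set \<Rightarrow> 'i set \<times> 'j set \<Rightarrow> bool" where
  "biclique R p \<longleftrightarrow> fst p \<times> snd p \<subseteq> R"

definition maxbicliques :: "('i \<times> 'j) set \<Rightarrow> ('i set \<times> 'j set) set" where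
  "maxbicliques R =
     {p. biclique R p \<and>
         (\<forall>q. biclique R q \<and> fst p \<subseteq> fst q \<and> snd p \<subseteq> snd q \<longrightarrow> q = p)}"

definition biclique_le :: "'i set \<times> 'j set \<Rightarrow> 'i set \<times> 'j set \<Rightarrow> bool" where
  "biclique_le p q \<longleftrightarrow> snd p \<subseteq> snd q"

text \<open>The maxbiclique lattice does not see whether an index is related to every index of the
  other side, repeats another index, or is an intersection of others; the two conditions
  below rule this out.  An index related to everything gives a zero row or column in every
  filled \<open>0\<close>-incidence matrix, which can still have rank \<open>d + 1\<close>, but excludes filled
  \<open>1\<close>-incidence matrices of rank \<open>d\<close>.  Distinct facets (extreme rays) of a cone
  contain (lie in) incomparable sets of extreme rays (facets), so a relation that is not
  \<open>irredundant\<close> is not the type of any cone or polytope.\<close>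

definition nondegenerate :: "('i \<times> 'j) set \<Rightarrow> bool" where
  "nondegenerate R \<longleftrightarrow> (\<forall>i. \<exists>j. (i, j) \<notin> R) \<and> (\<forall>j. \<exists>i. (i, j) \<notin> R)"

definition irredundant :: "('i \<times> 'j) set \<Rightarrow> bool" where
  "irredundant R \<longleftrightarrow>
     (\<forall>i i'. {j. (i, j) \<in> R} \<subseteq> {j. (i', j) \<in> R} \<longrightarrow> i = i') \<and>
     (\<forall>j j'. {i. (i, j) \<in> R} \<subseteq> {i. (i, j') \<in> R} \<longrightarrow> j = j')"

definition filled_incidence :: "real \<Rightarrow> ('i \<times> 'j) set \<Rightarrow> real^'j^'i \<Rightarrow> bool" where
  "filled_incidence x R M \<longleftrightarrow>
     (\<forall>i j. if (i, j) \<in> R then M $ i $ j = x else M $ i $ j < x)"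

definition filled0_matrices :: "('i::finite \<times> 'j::finite) set \<Rightarrow> nat \<Rightarrow> (real^'j^'i) set" where
  "filled0_matrices R r = {N. filled_incidence 0 R N \<and> rank N = r}"

definition positive_diagonal :: "real^'n^'n \<Rightarrow> bool" where
  "positive_diagonal D \<longleftrightarrow> (\<forall>i j. if i = j then 0 < D $ i $ j else D $ i $ j = 0)"

definition scaling_rel :: "(real^'j::finite^'i::finite) set \<Rightarrow> ((real^'j^'i) \<times> (real^'j^'i)) set" where
  "scaling_rel S =
     {(N, N'). N \<in> S \<and> N' \<in> S \<and>
        (\<exists>D1 D2. positive_diagonal D1 \<and> positive_diagonal D2 \<and> N' = D1 ** N ** D2)}"


section \<open>Cones and facet-ray matrices\<close>

definition pointed_cone :: "'v::euclidean_space set \<Rightarrow> bool" where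
  "pointed_cone C \<longleftrightarrow>
     (\<exists>S. finite S \<and> C = convex_cone hull S) \<and>
     \<not> (\<exists>a u. u \<noteq> 0 \<and> (\<forall>t::real. a + t *\<^sub>R u \<in> C))"

definition generators :: "'v::euclidean_space set \<Rightarrow> 'v set \<Rightarrow> bool" where
  "generators W C \<longleftrightarrow> convex_cone hull W = C \<and> (\<forall>W'. W' \<subset> W \<longrightarrow> convex_cone hull W' \<noteq> C)"

definition polar_cone :: "'v::euclidean_space set \<Rightarrow> 'v set" where
  "polar_cone C = {y. \<forall>x\<in>C. y \<bullet> x \<le> 0}"

text \<open>Facets and extreme rays carry their labels: \<open>F i\<close> is facet \<open>i\<close> and \<open>E j\<close> is extreme ray
  \<open>j\<close>.\<close>

definition type_cone ::
    "('i \<times> 'j) set \<Rightarrow> 'v::euclidean_space set \<Rightarrow> ('i \<Rightarrow> 'v set) \<Rightarrow> ('j \<Rightarrow> 'v set) \<Rightarrow> bool" where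
  "type_cone R C F E \<longleftrightarrow>
     pointed_cone C \<and>
     bij_betw F UNIV {T. T facet_of C} \<and>
     bij_betw E UNIV {T. T edge_of C} \<and>
     (\<forall>i j. E j \<subseteq> F i \<longleftrightarrow> (i, j) \<in> R)"

definition facet_ray_matrix ::
    "'v::euclidean_space set \<Rightarrow> ('i \<Rightarrow> 'v set) \<Rightarrow> ('j \<Rightarrow> 'v set) \<Rightarrow> real^'j^'i \<Rightarrow> bool" where
  "facet_ray_matrix C F E N \<longleftrightarrow>
     pointed_cone C \<and> interior C \<noteq> {} \<and>
     (\<exists>h w. generators (range w) C \<and> (\<forall>j. E j = convex_cone hull {w j}) \<and>
            generators (range h) (polar_cone C) \<and> (\<forall>i. F i = {x \<in> C. h i \<bullet> x = 0}) \<and>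
            (\<forall>i j. N $ i $ j = h i \<bullet> w j))"


section \<open>Polytopes modulo projective transformations\<close>

text \<open>A realization consists of a polytope together with the labelling of its facets and
  vertices.\<close>

type_synonym ('i, 'j, 'v) realization = "'v set \<times> ('i \<Rightarrow> 'v set) \<times> ('j \<Rightarrow> 'v)"

definition type_polytopes ::
    "('i \<times> 'j) set \<Rightarrow> ('i, 'j, 'v::euclidean_space) realization set" where
  "type_polytopes R =
     {(P, G, v). polytope P \<and>
        bij_betw G UNIV {T. T facet_of P} \<and>
        bij_betw v UNIV {x. x extreme_point_of P} \<and>
        (\<forall>i j. v j \<in> G i \<longleftrightarrow> (i, j) \<in> R)}"

text \<open>The projective map induced by a linear automorphism \<open>T\<close> in homogeneous coordinates; it is
  applied only to polytopes that avoid the hyperplane sent to infinity.\<close>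

definition projective_map ::
    "('v \<times> real \<Rightarrow> 'v \<times> real) \<Rightarrow> 'v::euclidean_space \<Rightarrow> 'v" where
  "projective_map T x = fst (T (x, 1)) /\<^sub>R snd (T (x, 1))"

definition projective_rel ::
    "('i \<times> 'j) set \<Rightarrow>
     (('i, 'j, 'v::euclidean_space) realization \<times> ('i, 'j, 'v) realization) set" where
  "projective_rel R =
     {((P, G, v), (P', G', v')).
        (P, G, v) \<in> type_polytopes R \<and> (P', G', v') \<in> type_polytopes R \<and>
        (\<exists>T. linear T \<and> bij T \<and> (\<forall>x\<in>P. snd (T (x, 1)) \<noteq> 0) \<and>
             P' = projective_map T ` P \<and>
             (\<forall>i. G' i = projective_map T ` G i) \<and>
             (\<forall>j. v' j = projective_map T (v j)))}"

definition homogenization :: "'v::euclidean_space set \<Rightarrow> ('v \<times> real) set" where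
  "homogenization P = {t *\<^sub>R (x, 1) | t x. 0 \<le> t \<and> x \<in> P}"

definition homogenization_matrices ::
    "('i, 'j, 'v::euclidean_space) realization \<Rightarrow> (real^'j^'i) set" where
  "homogenization_matrices = (\<lambda>(P, G, v).
     {N. facet_ray_matrix (homogenization P)
           (\<lambda>i. homogenization (G i)) (\<lambda>j. homogenization {v j}) N})"

end

(* Write a filled 0-incidence matrix N of rank d + 1 as N = (h_i . w_j) with h_i, w_j in R^(d+1).
   Along a flag of the maxbiclique lattice the d + 2 spans of {w_j : j in J_0} strictly increase, so
   their dimensions are exactly 0, ..., d + 1; in particular every filled 0-incidence matrix has rank
   at least d + 1, and the rank of a maxbiclique is the dimension of its span.  The cone generated by
   the w_j is then all of {x : h_i . x <= 0}: by induction on the rank, each maxbiclique spans a face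
   cut out by the inequalities of its lower covers.  A point satisfying these inequalities slides to
   one of the bounding hyperplanes, and there the diamond property supplies the inequalities needed
   for the induction hypothesis.  Irredundancy makes the h_i and w_j the exact facets and rays.

   For the two rank conditions, rescaling rows and columns turns N into a matrix whose sum with the
   all-ones matrix has rank one less; factoring that matrix as (a_i . v_j) gives the realization
   N ~ (a_i . v_j - 1) of the class of N by the polytope conv {v_j} = {x : a_i . x <= 1}. *)
theory Submission
  imports Defs
begin

section \<open>The maxbiclique lattice\<close>

text \<open>What ties rows to each other is that a functional vanishing on a subspace of codimension
  one is unique up to a factor, whose sign the inequalities fix. This lets an inequality pass from
  one row to another in the induction, and it turns a projective map into row factors. It needs
  dimensions that rise in steps of exactly one, hence the exact rank d + 1. The rank-lowering
  rescaling is a projection. With H the sum of the h_i and W the sum of the w_j, projecting each w_j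
  along W onto the hyperplane H . x = 0 adds to N the rank-one matrix with entries r_i c_j / sigma,
  where r_i = -h_i . W, c_j = -H . w_j and sigma = -H . W. All three are positive by nondegeneracy,
  so positive scalings turn this matrix into all ones. Geometrically the cone is cut by the affine
  hyperplane -H . x = 1, which meets every ray, and W gives the origin of the cross-section. So the
  realization obtained is bounded and has the origin in its interior.\<close>

lemma maxbicliques_iff:
  "p \<in> maxbicliques R \<longleftrightarrow>
     fst p = {i. \<forall>j\<in>snd p. (i, j) \<in> R} \<and> snd p = {j. \<forall>i\<in>fst p. (i, j) \<in> R}"
  (is "_ \<longleftrightarrow> fst p = ?I \<and> snd p = ?J")
proof
  assume p: "p \<in> maxbicliques R"
  then have "biclique R p"
    and max: "\<And>q. biclique R q \<Longrightarrow> fst p \<subseteq> fst q \<Longrightarrow> snd p \<subseteq> snd q \<Longrightarrow> q = p"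
    unfolding maxbicliques_def by blast+
  then have sub: "fst p \<subseteq> ?I" "snd p \<subseteq> ?J"
    by (auto simp: biclique_def)
  have "(?I, snd p) = p"
    by (rule max) (use sub in \<open>auto simp: biclique_def\<close>)
  moreover have "(fst p, ?J) = p"
    by (rule max) (use sub in \<open>auto simp: biclique_def\<close>)
  ultimately show "fst p = ?I \<and> snd p = ?J"
    by (simp add: prod_eq_iff)
next
  assume closed: "fst p = ?I \<and> snd p = ?J"
  have "q = p" if q: "biclique R q" "fst p \<subseteq> fst q" "snd p \<subseteq> snd q" for q
  proof -
    have "fst q \<subseteq> ?I" "snd q \<subseteq> ?J"
      using q unfolding biclique_def by blast+
    then show ?thesis
      using closed[THEN conjunct1] closed[THEN conjunct2] q
      by (metis prod_eq_iff subset_antisym)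
  qed
  moreover have "biclique R p"
    using closed unfolding biclique_def by blast
  ultimately show "p \<in> maxbicliques R"
    unfolding maxbicliques_def by blast
qed

lemma maxbiclique_row:
  "p \<in> maxbicliques R \<Longrightarrow> i \<in> fst p \<longleftrightarrow> (\<forall>j\<in>snd p. (i, j) \<in> R)"
  by (subst (asm) maxbicliques_iff) blast

lemma maxbiclique_column:
  "p \<in> maxbicliques R \<Longrightarrow> j \<in> snd p \<longleftrightarrow> (\<forall>i\<in>fst p. (i, j) \<in> R)"
  by (subst (asm) maxbicliques_iff) blast

lemma maxbiclique_mem: "p \<in> maxbicliques R \<Longrightarrow> i \<in> fst p \<Longrightarrow> j \<in> snd p \<Longrightarrow> (i, j) \<in> R"
  by (simp add: maxbiclique_row)

text \<open>Closure under the Galois connection of \<open>R\<close>. For \<open>I = {i}\<close> its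
  columns are those of row i, which makes it the candidate for facet i.\<close>

lemma maxbiclique_of_rows:
  "({i. \<forall>j. (\<forall>i'\<in>I. (i', j) \<in> R) \<longrightarrow> (i, j) \<in> R}, {j. \<forall>i\<in>I. (i, j) \<in> R}) \<in> maxbicliques R"
  unfolding maxbicliques_iff by auto

lemma maxbiclique_eqI:
  assumes "p \<in> maxbicliques R" "q \<in> maxbicliques R" "snd p = snd q"
  shows "p = q"
  using maxbiclique_row[OF assms(1)] maxbiclique_row[OF assms(2)] assms(3)
  by (auto intro!: prod_eqI)

lemma maxbiclique_psubset:
  assumes "p \<in> maxbicliques R" "q \<in> maxbicliques R" "\<not> snd q \<subseteq> snd p"
  obtains i j where "i \<in> fst p" "j \<in> snd q" "(i, j) \<notin> R"
proof -
  obtain j where "j \<in> snd q" "j \<notin> snd p" using assms by blast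
  moreover then obtain i where "i \<in> fst p" "(i, j) \<notin> R"
    using maxbiclique_column[OF assms(1)] by blast
  ultimately show thesis using that by blast
qed

lemma biclique_le_chain_iff:
  "pred_on.chain A biclique_le C \<longleftrightarrow>
     C \<subseteq> A \<and> (\<forall>p\<in>C. \<forall>q\<in>C. snd p \<subseteq> snd q \<or> snd q \<subseteq> snd p)"
  unfolding pred_on.chain_def biclique_le_def by blast

lemma chain_subset_flag:
  assumes "finite A" "pred_on.chain A le D"
  obtains C where "C \<in> flags A le" "D \<subseteq> C"
proof -
  let ?X = "{C. pred_on.chain A le C \<and> D \<subseteq> C}"
  have "finite ?X"
    by (rule finite_subset[of _ "Pow A"]) (use assms in \<open>auto simp: pred_on.chain_def\<close>)
  then obtain C where "C \<in> ?X" "\<forall>C'\<in>?X. C \<subseteq> C' \<longrightarrow> C = C'"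
    using finite_has_maximal[of ?X] assms(2) by blast
  then have "C \<in> flags A le" "D \<subseteq> C"
    unfolding flags_def pred_on.maxchain_def by blast+
  then show thesis using that by blast
qed

lemma flagD:
  assumes "C \<in> flags A biclique_le"
  shows "C \<subseteq> A" "\<And>p q. p \<in> C \<Longrightarrow> q \<in> C \<Longrightarrow> snd p \<subseteq> snd q \<or> snd q \<subseteq> snd p"
  using assms unfolding flags_def pred_on.maxchain_def biclique_le_chain_iff by blast+

lemma flag_maximal:
  assumes C: "C \<in> flags A biclique_le" and "r \<in> A"
    and "\<And>p. p \<in> C \<Longrightarrow> snd p \<subseteq> snd r \<or> snd r \<subseteq> snd p"
  shows "r \<in> C"
proof (rule ccontr)
  assume "r \<notin> C"
  moreover have "pred_on.chain A biclique_le (insert r C)"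
    using assms flagD[OF C] unfolding biclique_le_chain_iff by blast
  ultimately show False
    using C unfolding flags_def pred_on.maxchain_def by blast
qed

text \<open>Gradedness and rank enter as one count: a flag of length d + 1 has d + 2
  elements.\<close>

locale diamond_relation =
  fixes R :: "('i::finite \<times> 'j::finite) set" and d :: nat
  assumes flag_card: "C \<in> flags (maxbicliques R) biclique_le \<Longrightarrow> card C = d + 2"
    and diamond: "diamond (maxbicliques R) biclique_le"
    and nondegenerate: "nondegenerate R"
begin

lemma row_complement: "\<exists>j. (i, j) \<notin> R" and column_complement: "\<exists>i. (i, j) \<notin> R"
  using nondegenerate by (auto simp: nondegenerate_def)

lemma top_mem: "({}, UNIV) \<in> maxbicliques R" and bot_mem: "(UNIV, {}) \<in> maxbicliques R"
  using row_complement column_complement by (auto simp: maxbicliques_iff)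

lemma flag_extend:
  assumes "D \<subseteq> maxbicliques R"
    and "\<And>p q. p \<in> D \<Longrightarrow> q \<in> D \<Longrightarrow> snd p \<subseteq> snd q \<or> snd q \<subseteq> snd p"
  obtains C where "C \<in> flags (maxbicliques R) biclique_le" "D \<subseteq> C"
  using chain_subset_flag[of "maxbicliques R" biclique_le D] assms
  by (auto simp: biclique_le_chain_iff)

lemma chain_card_le:
  assumes "D \<subseteq> maxbicliques R"
    and "\<And>p q. p \<in> D \<Longrightarrow> q \<in> D \<Longrightarrow> snd p \<subseteq> snd q \<or> snd q \<subseteq> snd p"
  shows "card D \<le> d + 2"
  using flag_extend[OF assms] flag_card by (metis card_mono finite_code)

end

section \<open>Vectors with a filled matrix of inner products\<close>

text \<open>The space is left open: the columns of a matrix paired with the standard basis give the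
  lower bound on the rank, while vectors in dimension d + 1 give the cone.\<close>

locale filled_vectors = diamond_relation R d for R :: "('i::finite \<times> 'j::finite) set" and d +
  fixes h :: "'i \<Rightarrow> 'v::euclidean_space" and w :: "'j \<Rightarrow> 'v"
  assumes inner_eq: "(i, j) \<in> R \<Longrightarrow> h i \<bullet> w j = 0"
    and inner_less: "(i, j) \<notin> R \<Longrightarrow> h i \<bullet> w j < 0"
begin

abbreviation L :: "('i set \<times> 'j set) set" where "L \<equiv> maxbicliques R"

definition D :: "'i set \<times> 'j set \<Rightarrow> nat" where "D p = dim (w ` snd p)"

lemma inner_le: "h i \<bullet> w j \<le> 0"
  using inner_eq inner_less by (cases "(i, j) \<in> R") force+

lemma inner_zero_iff: "h i \<bullet> w j = 0 \<longleftrightarrow> (i, j) \<in> R"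
  using inner_eq inner_less by force

lemma inner_span:
  assumes "p \<in> L" "i \<in> fst p" "x \<in> span (w ` snd p)"
  shows "h i \<bullet> x = 0"
proof -
  have "span (w ` snd p) \<subseteq> {x. h i \<bullet> x = 0}"
    using assms by (intro span_minimal subspace_hyperplane) (auto simp: inner_eq maxbiclique_mem)
  then show ?thesis using assms by blast
qed

lemma D_mono: "snd p \<subseteq> snd q \<Longrightarrow> D p \<le> D q"
  unfolding D_def by (intro dim_subset image_mono)

text \<open>A row of \<open>p\<close> that misses a column of \<open>q\<close> is a hyperplane
  containing the span of \<open>p\<close> but not the vector of that column.\<close>

lemma D_less:
  assumes "p \<in> L" "q \<in> L" "snd p \<subset> snd q"
  shows "D p < D q"
proof -
  obtain i j where ij: "i \<in> fst p" "j \<in> snd q" "(i, j) \<notin> R"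
    using maxbiclique_psubset assms by (metis psubsetE)
  then have "w j \<notin> span (w ` snd p)"
    using inner_span inner_less assms(1) by (metis less_irrefl)
  then have "dim (insert (w j) (w ` snd p)) = D p + 1"
    by (simp add: dim_insert D_def)
  moreover have "dim (insert (w j) (w ` snd p)) \<le> D q"
    unfolding D_def using ij assms by (intro dim_subset) auto
  ultimately show ?thesis by simp
qed

lemma D_le: "D p \<le> dim (range w)"
  unfolding D_def by (intro dim_subset) auto

lemma inj_on_D:
  assumes "C \<in> flags L biclique_le"
  shows "inj_on D C"
proof (rule inj_onI)
  fix p q assume pq: "p \<in> C" "q \<in> C" "D p = D q"
  then have "p \<in> L" "q \<in> L" using flagD[OF assms] by auto
  moreover have "\<not> snd p \<subset> snd q" "\<not> snd q \<subset> snd p"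
    using D_less[of p q] D_less[of q p] pq \<open>p \<in> L\<close> \<open>q \<in> L\<close> by auto
  ultimately show "p = q"
    using flagD(2)[OF assms pq(1,2)] by (intro maxbiclique_eqI) auto
qed

lemma dim_ge: "d + 1 \<le> dim (range w)"
proof -
  obtain C where C: "C \<in> flags L biclique_le"
    using flag_extend[of "{}"] by auto
  have "d + 2 = card (D ` C)"
    using C flag_card inj_on_D card_image by metis
  also have "\<dots> \<le> card {..dim (range w)}"
    by (intro card_mono) (auto simp: D_le)
  finally show ?thesis by simp
qed

end

text \<open>The columns of \<open>N\<close>, tested against the standard basis, have the entries of
  \<open>N\<close> as inner products, and their span has dimension \<open>rank N\<close>.\<close>

lemma (in diamond_relation) rank_ge:
  fixes N :: "real^'j^'i"
  assumes "filled_incidence 0 R N"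
  shows "d + 1 \<le> rank N"
proof -
  interpret filled_vectors R d "\<lambda>i. axis i 1" "\<lambda>j. column j N"
    by unfold_locales
      (use assms in \<open>auto simp: filled_incidence_def inner_axis' column_def split: if_splits\<close>)
  show ?thesis
    using dim_ge by (simp add: column_rank_def columns_def full_SetCompr_eq)
qed

section \<open>Functionals on a subspace of codimension one\<close>

lemma span_insert_eq:
  fixes A B :: "'v::euclidean_space set"
  assumes "B \<subseteq> A" "dim A = dim B + 1" "a \<in> A" "a \<notin> span B"
  shows "span A = span (insert a B)"
  using assms dim_eq_span[of "insert a B" A] by (auto simp: dim_insert)

lemma mem_span_of_inner_zero:
  fixes f :: "'v::euclidean_space"
  assumes "B \<subseteq> A" "dim A = dim B + 1" "a \<in> A" "f \<bullet> a \<noteq> 0"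
    and f0: "\<And>b. b \<in> B \<Longrightarrow> f \<bullet> b = 0" and x: "x \<in> span A" "f \<bullet> x = 0"
  shows "x \<in> span B"
proof -
  have B0: "span B \<subseteq> {x. f \<bullet> x = 0}"
    by (intro span_minimal subspace_hyperplane) (use f0 in auto)
  then have "x \<in> span (insert a B)"
    using assms span_insert_eq[of B A a] by auto
  then obtain k where k: "x - k *\<^sub>R a \<in> span B"
    by (auto simp: span_breakdown_eq)
  then have "f \<bullet> (x - k *\<^sub>R a) = 0" using B0 by blast
  then have "k = 0" using assms by (simp add: inner_diff_right)
  then show ?thesis using k by simp
qed

text \<open>Both functionals factor through the one-dimensional quotient of \<open>span A\<close> by
  \<open>span B\<close>, so they differ by a scalar there, and two negative values make it
  positive.\<close>

lemma proportional_functionals: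
  fixes f g :: "'v::euclidean_space"
  assumes BA: "B \<subseteq> A" "dim A = dim B + 1"
    and f: "\<And>b. b \<in> B \<Longrightarrow> f \<bullet> b = 0" "\<And>a. a \<in> A \<Longrightarrow> f \<bullet> a \<le> 0" "\<exists>a\<in>A. f \<bullet> a < 0"
    and g: "\<And>b. b \<in> B \<Longrightarrow> g \<bullet> b = 0" "\<And>a. a \<in> A \<Longrightarrow> g \<bullet> a \<le> 0" "\<exists>a\<in>A. g \<bullet> a < 0"
  obtains c where "c > 0" "\<And>x. x \<in> span A \<Longrightarrow> g \<bullet> x = c * (f \<bullet> x)"
proof -
  obtain a where a: "a \<in> A" "f \<bullet> a < 0" using f(3) by blast
  have "span B \<subseteq> {x. f \<bullet> x = 0}"
    by (intro span_minimal subspace_hyperplane) (use f in auto)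
  then have "a \<notin> span B" using a by auto
  then have sp: "span A = span (insert a B)"
    using BA a by (intro span_insert_eq) auto
  have "g \<bullet> a \<noteq> 0"
  proof
    assume "g \<bullet> a = 0"
    then have "span A \<subseteq> {x. g \<bullet> x = 0}"
      unfolding sp by (intro span_minimal subspace_hyperplane) (use g in auto)
    then show False using g(3) by (auto dest: span_base)
  qed
  then have ga: "g \<bullet> a < 0" using g(2)[OF a(1)] by simp
  define c where "c = (g \<bullet> a) / (f \<bullet> a)"
  have "span A \<subseteq> {x. (g - c *\<^sub>R f) \<bullet> x = 0}"
    unfolding sp
    by (intro span_minimal subspace_hyperplane) (use f g a in \<open>auto simp: inner_diff_left c_def\<close>)
  then have "g \<bullet> x = c * (f \<bullet> x)" if "x \<in> span A" for x
    using that by (auto simp: inner_diff_left)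
  moreover have "c > 0" using ga a unfolding c_def by (simp add: divide_neg_neg)
  ultimately show thesis using that by blast
qed

section \<open>Finitely generated cones\<close>

lemma convex_cone_hull_range:
  fixes w :: "'j::finite \<Rightarrow> 'v::real_vector"
  shows "convex_cone hull (range w) = {x. \<exists>c. (\<forall>j. 0 \<le> c j) \<and> x = (\<Sum>j\<in>UNIV. c j *\<^sub>R w j)}"
    (is "_ = ?S")
proof (rule hull_unique)
  show "range w \<subseteq> ?S"
  proof clarify
    fix j
    have "w j = (\<Sum>k\<in>UNIV. (if k = j then 1 else 0) *\<^sub>R w k)"
      by (simp add: if_distrib[of "\<lambda>c. c *\<^sub>R _"] cong: if_cong)
    then show "\<exists>c. (\<forall>j. 0 \<le> c j) \<and> w j = (\<Sum>j\<in>UNIV. c j *\<^sub>R w j)"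
      by (intro exI[of _ "\<lambda>k. if k = j then 1 else 0"]) auto
  qed
  show "convex_cone ?S"
    unfolding convex_cone_iff
  proof (intro conjI ballI allI impI)
    show "0 \<in> ?S" by (auto intro!: exI[of _ "\<lambda>_. 0"])
  next
    fix x y assume "x \<in> ?S" "y \<in> ?S"
    then obtain c e where "\<forall>j. 0 \<le> c j" "x = (\<Sum>j\<in>UNIV. c j *\<^sub>R w j)"
      "\<forall>j. 0 \<le> e j" "y = (\<Sum>j\<in>UNIV. e j *\<^sub>R w j)" by blast
    then show "x + y \<in> ?S"
      by (auto intro!: exI[of _ "\<lambda>j. c j + e j"] simp: sum.distrib scaleR_add_left)
  next
    fix x and a :: real assume "x \<in> ?S" "0 \<le> a"
    then obtain c where "\<forall>j. 0 \<le> c j" "x = (\<Sum>j\<in>UNIV. c j *\<^sub>R w j)" by blast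
    then show "a *\<^sub>R x \<in> ?S"
      using \<open>0 \<le> a\<close> by (auto intro!: exI[of _ "\<lambda>j. a * c j"] simp: scaleR_sum_right)
  qed
next
  fix T assume T: "range w \<subseteq> T" "convex_cone T"
  have "(\<Sum>j\<in>X. c j *\<^sub>R w j) \<in> T" if "\<forall>j. 0 \<le> c j" for c X
    using finite[of X]
  proof (induction X rule: finite_induct)
    case empty
    then show ?case using T convex_cone_contains_0 by simp
  next
    case (insert j X)
    then show ?case using T that by (auto intro!: convex_cone_add convex_cone_scaleR)
  qed
  then show "?S \<subseteq> T" by blast
qed

lemma convex_cone_hull_singleton:
  fixes w :: "'v::real_vector"
  shows "convex_cone hull {w} = {t *\<^sub>R w | t. 0 \<le> t}"
proof -
  have "convex_cone hull (range (\<lambda>_::unit. w)) = {t *\<^sub>R w | t. 0 \<le> t}"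
    unfolding convex_cone_hull_range by (auto simp: UNIV_unit)
  then show ?thesis by simp
qed

lemma sum_mem_convex_cone_hull:
  fixes w :: "'j::finite \<Rightarrow> 'v::real_vector"
  shows "(\<Sum>j\<in>X. w j) \<in> convex_cone hull (range w)"
  unfolding convex_cone_hull_range
  by (auto intro!: exI[of _ "\<lambda>j. if j \<in> X then 1 else 0"]
      simp: if_distrib[of "\<lambda>c. c *\<^sub>R _"] sum.If_cases cong: if_cong)

text \<open>An open half-space with 0 adjoined is a convex cone. This serves both the minimality of
  generators and pointedness.\<close>

lemma convex_cone_hull_neg:
  fixes g :: "'v::real_inner"
  assumes "\<And>x. x \<in> W \<Longrightarrow> g \<bullet> x < 0" and "x \<in> convex_cone hull W"
  shows "x = 0 \<or> g \<bullet> x < 0"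
proof -
  have "convex_cone {x. x = 0 \<or> g \<bullet> x < 0}"
    unfolding convex_cone_iff by (auto simp: inner_add_right mult_pos_neg)
  then have "convex_cone hull W \<subseteq> {x. x = 0 \<or> g \<bullet> x < 0}"
    by (intro hull_minimal) (use assms in auto)
  then show ?thesis using assms by blast
qed

text \<open>Without \<open>w j\<close>, the functional \<open>g j\<close> is negative on all
  remaining generators and so on every nonzero point of their cone, but it vanishes at the nonzero
  vector \<open>w j\<close>.\<close>

lemma generators_range:
  fixes w :: "'j::finite \<Rightarrow> 'v::euclidean_space"
  assumes "\<And>j. w j \<noteq> 0"
    and exposed: "\<And>j. g j \<bullet> w j = 0" "\<And>j k. k \<noteq> j \<Longrightarrow> g j \<bullet> w k < 0"
  shows "generators (range w) (convex_cone hull range w)"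
  unfolding generators_def
proof (intro conjI allI impI refl notI)
  fix W assume W: "W \<subset> range w" "convex_cone hull W = convex_cone hull range w"
  then obtain j where "w j \<notin> W" by blast
  then have "g j \<bullet> x < 0" if "x \<in> W" for x
    using that W exposed(2) by (metis imageE psubsetD)
  moreover have "w j \<in> convex_cone hull W"
    using W by (simp add: hull_inc)
  ultimately have "w j = 0 \<or> g j \<bullet> w j < 0"
    by (intro convex_cone_hull_neg)
  then show False using assms by (metis less_irrefl)
qed

text \<open>The terms \<open>c k * (g \<bullet> w k)\<close> of a nonnegative combination are all
  nonpositive, so if they add up to 0 every coefficient other than \<open>c j\<close>
  vanishes.\<close>

lemma convex_cone_hull_exposed:
  fixes w :: "'j::finite \<Rightarrow> 'v::real_inner"
  assumes "g \<bullet> w j = 0" "\<And>k. k \<noteq> j \<Longrightarrow> g \<bullet> w k < 0"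
  shows "convex_cone hull {w j} = convex_cone hull (range w) \<inter> {x. g \<bullet> x = 0}"
proof
  have "convex_cone hull {w j} \<subseteq> convex_cone hull range w"
    by (intro hull_mono) auto
  then show "convex_cone hull {w j} \<subseteq> convex_cone hull (range w) \<inter> {x. g \<bullet> x = 0}"
    using assms by (auto simp: convex_cone_hull_singleton)
  show "convex_cone hull (range w) \<inter> {x. g \<bullet> x = 0} \<subseteq> convex_cone hull {w j}"
  proof clarify
    fix x assume "x \<in> convex_cone hull (range w)" and 0: "g \<bullet> x = 0"
    then obtain c where c: "\<And>k. 0 \<le> c k" "x = (\<Sum>k\<in>UNIV. c k *\<^sub>R w k)"
      unfolding convex_cone_hull_range by blast
    have "(\<Sum>k\<in>UNIV. c k * (g \<bullet> w k)) = 0"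
      using 0 c by (simp add: inner_sum_right)
    then have "(\<Sum>k\<in>UNIV. - (c k * (g \<bullet> w k))) = 0"
      by (simp add: sum_negf)
    moreover have "0 \<le> - (c k * (g \<bullet> w k))" for k
      using assms c by (cases "k = j") (auto simp: mult_nonneg_nonpos less_imp_le)
    ultimately have "- (c k * (g \<bullet> w k)) = 0" for k
      using sum_nonneg_eq_0_iff[of UNIV "\<lambda>k. - (c k * (g \<bullet> w k))"] by auto
    then have "c k = 0" if "k \<noteq> j" for k
      using assms(2)[OF that] by (metis less_irrefl mult_eq_0_iff neg_equal_0_iff_equal)
    then have "x = c j *\<^sub>R w j"
      unfolding c(2) by (subst sum.remove[of _ j]) auto
    then show "x \<in> convex_cone hull {w j}"
      using c by (auto simp: convex_cone_hull_singleton)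
  qed
qed

lemma facet_of_irredundant_polyhedron:
  fixes a :: "'i::finite \<Rightarrow> 'v::euclidean_space"
  assumes S: "S = {x. \<forall>i. a i \<bullet> x \<le> b i}" and int: "interior S \<noteq> {}"
    and irred: "\<And>i. \<exists>x. b i < a i \<bullet> x \<and> (\<forall>k. k \<noteq> i \<longrightarrow> a k \<bullet> x \<le> b k)"
    and nonzero: "\<And>i. a i \<noteq> 0"
  shows "T facet_of S \<longleftrightarrow> (\<exists>i. T = S \<inter> {x. a i \<bullet> x = b i})"
proof -
  define H where "H i = {x. a i \<bullet> x \<le> b i}" for i
  have inj: "inj H"
  proof
    fix i k assume "H i = H k"
    then show "i = k" using irred[of i] unfolding H_def by (metis mem_Collect_eq not_less)
  qed
  have aff: "affine hull S = UNIV"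
    using int by (simp add: affine_hull_nonempty_interior)
  have "T facet_of S \<longleftrightarrow>
      (\<exists>X. X \<in> range H \<and> T = S \<inter> {x. (a \<circ> inv H) X \<bullet> x = (b \<circ> inv H) X})"
  proof (rule facet_of_polyhedron_explicit)
    show "S = affine hull S \<inter> \<Inter> (range H)"
      by (simp add: aff) (auto simp: S H_def)
    show "(a \<circ> inv H) X \<noteq> 0 \<and> X = {x. (a \<circ> inv H) X \<bullet> x \<le> (b \<circ> inv H) X}"
      if "X \<in> range H" for X
    proof -
      obtain i where "X = H i" using \<open>X \<in> range H\<close> by blast
      then show ?thesis using nonzero inj by (simp add: inv_f_f) (simp add: H_def)
    qed
    show "S \<subset> affine hull S \<inter> \<Inter> X" if X: "X \<subset> range H" for X
    proof -
      obtain i where i: "H i \<notin> X" using X by blast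
      obtain x where x: "b i < a i \<bullet> x" "\<forall>k. k \<noteq> i \<longrightarrow> a k \<bullet> x \<le> b k" using irred by blast
      have "x \<in> \<Inter> X"
      proof
        fix Y assume "Y \<in> X"
        then obtain k where "Y = H k" "k \<noteq> i" using X i by blast
        then show "x \<in> Y" using x by (simp add: H_def)
      qed
      moreover have "x \<notin> S" using x by (auto simp: S not_le)
      moreover have "S \<subseteq> \<Inter> X" using X by (auto simp: S H_def)
      ultimately show ?thesis by (auto simp: aff)
    qed
  qed simp
  then show ?thesis using inj by (auto simp: inv_f_f)
qed

section \<open>Recovering the cone from its facet-ray inequalities\<close>

locale full_filled_vectors = filled_vectors R d h w
  for R :: "('i::finite \<times> 'j::finite) set" and d
    and h :: "'i \<Rightarrow> 'v::euclidean_space" and w :: "'j \<Rightarrow> 'v" +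
  assumes dim_space: "DIM('v) = d + 1"
begin

lemma dim_range: "dim (range w) = d + 1"
  using dim_ge dim_subset_UNIV[of "range w"] dim_space by simp

lemma span_range: "span (range w) = UNIV"
  using dim_range dim_space by (metis dim_eq_full)

lemma D_image_flag:
  assumes "C \<in> flags L biclique_le"
  shows "D ` C = {..d + 1}"
proof (rule card_subset_eq)
  show "D ` C \<subseteq> {..d + 1}" using D_le dim_range by auto
  show "card (D ` C) = card {..d + 1}"
    using flag_card[OF assms] inj_on_D[OF assms] by (simp add: card_image)
qed simp

text \<open>A flag below \<open>p\<close> extends to a flag of the whole lattice, on which
  \<open>D\<close> takes every value once; the members of dimension at most \<open>D p\<close> are
  those below \<open>p\<close>. The diamond condition thereby becomes one on dimensions.\<close>

lemma element_rank_eq: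
  assumes p: "p \<in> L"
  shows "element_rank L biclique_le p = D p"
proof -
  let ?P = "{x \<in> L. biclique_le x p}"
  have *: "card E = Suc (D p)" if E: "E \<in> flags ?P biclique_le" for E
  proof -
    have pE: "p \<in> E"
      by (rule flag_maximal[OF E]) (use p flagD(1)[OF E] in \<open>auto simp: biclique_le_def\<close>)
    obtain C where C: "C \<in> flags L biclique_le" "E \<subseteq> C"
      using flag_extend[of E] flagD[OF E] by blast
    have "D ` E = {..D p}"
    proof
      show "D ` E \<subseteq> {..D p}"
        using flagD(1)[OF E] D_mono unfolding biclique_le_def by blast
      show "{..D p} \<subseteq> D ` E"
      proof
        fix n assume n: "n \<in> {..D p}"
        then have "n \<in> D ` C"
          using D_image_flag[OF C(1)] D_le[of p] dim_range by auto
        then obtain x where x: "x \<in> C" "n = D x" by blast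
        then have "x \<in> L" using flagD[OF C(1)] by blast
        have "snd x \<subseteq> snd p"
          using flagD(2)[OF C(1), of x p] D_less[OF p \<open>x \<in> L\<close>] x n C(2) pE by auto
        then have "x \<in> {y \<in> L. biclique_le y p}"
          using \<open>x \<in> L\<close> by (simp add: biclique_le_def)
        then have "x \<in> E"
          using flag_maximal[OF E] flagD(2)[OF C(1) _ x(1)] C(2) by blast
        then show "n \<in> D ` E" using x by blast
      qed
    qed
    moreover have "inj_on D E" using inj_on_D[OF C(1)] C(2) by (rule inj_on_subset)
    ultimately show ?thesis by (metis card_atMost card_image)
  qed
  obtain E where "E \<in> flags ?P biclique_le"
    using chain_subset_flag[of ?P biclique_le "{}"] by (auto simp: pred_on.chain_def)
  then show ?thesis
    unfolding element_rank_def poset_rank_def using * by (intro the_equality) auto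
qed

lemma lower_cover:
  assumes "q \<in> L" "0 < D q"
  obtains p where "p \<in> L" "snd p \<subset> snd q" "D q = D p + 1"
proof -
  obtain C where C: "C \<in> flags L biclique_le" "q \<in> C"
    using flag_extend[of "{q}"] assms by auto
  have "D q - 1 \<in> D ` C"
    using D_image_flag[OF C(1)] D_le[of q] dim_range by auto
  then obtain p where p: "p \<in> C" "D p = D q - 1" by auto
  then have "p \<in> L" using flagD[OF C(1)] by blast
  moreover have "snd p \<subset> snd q"
    using flagD(2)[OF C(1) p(1) C(2)] p(2) D_mono[of q p] assms by auto
  ultimately show thesis using that p assms by simp
qed

text \<open>The interval from \<open>p'\<close> to \<open>q\<close> has four elements, so one exists
  besides \<open>p'\<close>, \<open>p\<close> and \<open>q\<close>. Its dimension lies strictly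
  between those of \<open>p'\<close> and \<open>q\<close>, which makes it a lower cover of
  \<open>q\<close> that is incomparable to \<open>p\<close>.\<close>

lemma other_cover:
  assumes "p' \<in> L" "p \<in> L" "q \<in> L" "snd p' \<subset> snd p" "snd p \<subset> snd q"
    and D: "D p = D p' + 1" "D q = D p + 1"
  obtains p'' where "p'' \<in> L" "snd p' \<subset> snd p''" "snd p'' \<subset> snd q" "\<not> snd p \<subseteq> snd p''"
    "D q = D p'' + 1"
proof -
  let ?X = "{x \<in> L. biclique_le p' x \<and> biclique_le x q}"
  have "card ?X = 4"
    using diamond assms unfolding diamond_def
    by (auto simp: element_rank_eq biclique_le_def)
  moreover have "card {p', p, q} \<le> 3" by (simp add: card_insert_if)
  ultimately have "\<not> ?X \<subseteq> {p', p, q}"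
    using card_mono[of "{p', p, q}" ?X] by fastforce
  then obtain x where x: "x \<in> L" "snd p' \<subseteq> snd x" "snd x \<subseteq> snd q" "x \<noteq> p'" "x \<noteq> p" "x \<noteq> q"
    by (auto simp: biclique_le_def)
  have s: "snd p' \<subset> snd x" "snd x \<subset> snd q"
    using x assms maxbiclique_eqI by blast+
  have "D p' < D x" "D x < D q" using s x(1) \<open>p' \<in> L\<close> \<open>q \<in> L\<close> by (blast intro: D_less)+
  then have Dx: "D q = D x + 1" using D by simp
  then have "\<not> snd p \<subset> snd x" using D_less[of p x] x(1) \<open>p \<in> L\<close> D Dx by auto
  then have "\<not> snd p \<subseteq> snd x" using x assms maxbiclique_eqI by blast
  then show thesis using that x s Dx by blast
qed

text \<open>Induction on the dimension of the face: slide \<open>x\<close> against an interior direction of the face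
  until it meets a bounding hyperplane.  By the diamond property, each ridge of the subface reached
  there lies in a second subface, whose inequality is on that subface a positive multiple of the
  required one.\<close>

lemma face_inequalities_imp_mem:
  assumes "q \<in> L" "x \<in> span (w ` snd q)"
    and "\<And>p i. p \<in> L \<Longrightarrow> snd p \<subset> snd q \<Longrightarrow> D q = D p + 1 \<Longrightarrow> i \<in> fst p \<Longrightarrow> i \<notin> fst q
      \<Longrightarrow> h i \<bullet> x \<le> 0"
  shows "x \<in> convex_cone hull range w"
  using assms
proof (induction "D q" arbitrary: q x rule: less_induct)
  case less
  show ?case
  proof (cases "D q = 0")
    case True
    then have "w ` snd q \<subseteq> {0}" by (simp add: D_def dim_eq_0)
    then have "span (w ` snd q) \<subseteq> {0}" by (intro span_minimal subspace_single_0)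
    then show ?thesis using less.prems(2) convex_cone_hull_contains_0 by auto
  next
    case False
    \<comment> \<open>The rows cutting out the subfaces of codimension one; rows vanishing on the
      whole face are excluded, since the slide divides by their value at \<open>y\<close>.\<close>
    define X where "X = {i. i \<notin> fst q \<and> (\<exists>p\<in>L. snd p \<subset> snd q \<and> D q = D p + 1 \<and> i \<in> fst p)}"
    obtain p where p: "p \<in> L" "snd p \<subset> snd q" "D q = D p + 1"
      using lower_cover less.prems(1) False by blast
    then obtain i j where ij: "i \<in> fst p" "j \<in> snd q" "(i, j) \<notin> R"
      using maxbiclique_psubset[of p R q] less.prems(1) by blast
    then have "i \<notin> fst q" using maxbiclique_mem[OF less.prems(1)] by blast
    then have "i \<in> X" using p ij unfolding X_def by blast
    then have "X \<noteq> {}" by blast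
    define y where "y = (\<Sum>j\<in>snd q. w j)"
    have y: "h i \<bullet> y < 0" if "i \<in> X" for i
    proof -
      obtain j where "j \<in> snd q" "(i, j) \<notin> R"
        using \<open>i \<in> X\<close> maxbiclique_row[OF less.prems(1)] unfolding X_def by blast
      then have "(\<Sum>j\<in>snd q. h i \<bullet> w j) < (\<Sum>j\<in>snd q. 0)"
        by (intro sum_strict_mono_ex1) (auto intro: inner_le inner_less)
      then show ?thesis by (simp add: y_def inner_sum_right)
    qed
    \<comment> \<open>Since \<open>h i \<bullet> y\<close> is negative,
      \<open>h i \<bullet> (x - t *\<^sub>R y) \<le> 0\<close> says that \<open>t\<close> is at most
      this ratio; the minimum is where the first hyperplane is met.\<close>
    define t where "t = Min ((\<lambda>i. (h i \<bullet> x) / (h i \<bullet> y)) ` X)"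
    have t_le: "t \<le> (h i \<bullet> x) / (h i \<bullet> y)" if "i \<in> X" for i
      unfolding t_def using that by (intro Min_le) auto
    have "t \<in> (\<lambda>i. (h i \<bullet> x) / (h i \<bullet> y)) ` X"
      unfolding t_def using \<open>X \<noteq> {}\<close> by (intro Min_in) auto
    then obtain i where i: "i \<in> X" "t = (h i \<bullet> x) / (h i \<bullet> y)" by blast
    have hx: "h i \<bullet> x \<le> 0" if "i \<in> X" for i
      using that less.prems(3) unfolding X_def by blast
    have "t \<ge> 0" using i y hx by (auto simp: divide_nonpos_neg)
    define z where "z = x - t *\<^sub>R y"
    have hz: "h i \<bullet> z \<le> 0" if "i \<in> X" for i
      using t_le[OF that] y[OF that] by (simp add: z_def inner_diff_right neg_le_divide_eq)
    have "h i \<bullet> z = 0"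
      using i y[OF i(1)] by (simp add: z_def inner_diff_right)
    have "z \<in> span (w ` snd q)"
      unfolding z_def y_def
      by (intro span_diff span_scale span_sum less.prems(2)) (auto intro: span_base)
    obtain p where p: "p \<in> L" "snd p \<subset> snd q" "D q = D p + 1" "i \<in> fst p" "i \<notin> fst q"
      using i(1) unfolding X_def by blast
    then obtain j where j: "j \<in> snd q" "(i, j) \<notin> R"
      using maxbiclique_row[OF less.prems(1)] by blast
    \<comment> \<open>The dimension drops by exactly one from \<open>q\<close> to \<open>p\<close>,
      so on the span of \<open>q\<close> the equation of row i already describes the span of
      \<open>p\<close>.\<close>
    have zp: "z \<in> span (w ` snd p)"
    proof (rule mem_span_of_inner_zero)
      show "w ` snd p \<subseteq> w ` snd q" "w j \<in> w ` snd q" using p j by auto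
      show "dim (w ` snd q) = dim (w ` snd p) + 1" using p by (simp add: D_def)
      show "h i \<bullet> w j \<noteq> 0" using j inner_less by fastforce
      show "h i \<bullet> b = 0" if "b \<in> w ` snd p" for b
        using that p(4) inner_eq maxbiclique_mem[OF p(1)] by blast
    qed fact+
    have "z \<in> convex_cone hull range w"
    proof (rule less.hyps[OF _ p(1) zp])
      show "D p < D q" using p by simp
      \<comment> \<open>The induction hypothesis asks for the inequality of a row k that may lie
        outside \<open>X\<close>. A row l of the second subface \<open>p''\<close> over
        \<open>p'\<close> stands in for it.\<close>
      fix p' k assume p': "p' \<in> L" "snd p' \<subset> snd p" "D p = D p' + 1" "k \<in> fst p'" "k \<notin> fst p"
      obtain p'' where p'': "p'' \<in> L" "snd p' \<subset> snd p''" "snd p'' \<subset> snd q"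
        "\<not> snd p \<subseteq> snd p''" "D q = D p'' + 1"
        using other_cover[OF p'(1) p(1) less.prems(1) p'(2) p(2) p'(3) p(3)] by blast
      obtain l j where l: "l \<in> fst p''" "j \<in> snd p" "(l, j) \<notin> R"
        using maxbiclique_psubset[OF p''(1) p(1)] p''(4) by blast
      have "l \<notin> fst q"
        using l p(2) maxbiclique_mem[OF less.prems(1)] by blast
      then have "l \<in> X" using l p'' unfolding X_def by blast
      obtain j' where j': "j' \<in> snd p" "(k, j') \<notin> R"
        using p'(5) maxbiclique_row[OF p(1)] by blast
      \<comment> \<open>Both rows vanish on \<open>p'\<close>, which has codimension one in
        \<open>p\<close>, and are nonpositive but not identically zero on the generators of
        \<open>p\<close>.\<close>
      obtain c where "c > 0" "\<And>x. x \<in> span (w ` snd p) \<Longrightarrow> h k \<bullet> x = c * (h l \<bullet> x)"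
      proof (rule proportional_functionals)
        show "w ` snd p' \<subseteq> w ` snd p" using p' by auto
        show "dim (w ` snd p) = dim (w ` snd p') + 1" using p' by (simp add: D_def)
        show "h l \<bullet> b = 0" "h k \<bullet> b = 0" if "b \<in> w ` snd p'" for b
          using that p'(4) p''(2) l(1) inner_eq maxbiclique_mem[OF p'(1)] maxbiclique_mem[OF p''(1)]
          by blast+
        show "\<exists>a\<in>w ` snd p. h l \<bullet> a < 0" "\<exists>a\<in>w ` snd p. h k \<bullet> a < 0"
          using l j' inner_less by blast+
      qed (auto simp: inner_le)
      then show "h k \<bullet> z \<le> 0"
        using zp hz[OF \<open>l \<in> X\<close>] by (simp add: mult_nonneg_nonpos)
    qed
    moreover have "t *\<^sub>R y \<in> convex_cone hull range w"
      unfolding y_def using \<open>t \<ge> 0\<close> by (intro convex_cone_hull_mul sum_mem_convex_cone_hull)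
    ultimately have "z + t *\<^sub>R y \<in> convex_cone hull range w" by (rule convex_cone_hull_add)
    then show ?thesis by (simp add: z_def)
  qed
qed

text \<open>At the top maxbiclique the span is the whole space, and the inequalities required there
  are among those assumed.\<close>

theorem cone_eq: "convex_cone hull range w = {x. \<forall>i. h i \<bullet> x \<le> 0}"
proof
  have "convex_cone (\<Inter>i. {x. h i \<bullet> x \<le> 0})"
    by (intro convex_cone_Inter) (auto simp: convex_cone_halfspace_le)
  then have "convex_cone {x. \<forall>i. h i \<bullet> x \<le> 0}" by (simp add: Collect_all_eq)
  then show "convex_cone hull range w \<subseteq> {x. \<forall>i. h i \<bullet> x \<le> 0}"
    by (intro hull_minimal) (auto simp: inner_le)
  show "{x. \<forall>i. h i \<bullet> x \<le> 0} \<subseteq> convex_cone hull range w"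
    using face_inequalities_imp_mem[OF top_mem] by (auto simp: span_range)
qed

end

section \<open>Polar cones and edges of finitely generated cones\<close>

lemma sum_neg:
  fixes f :: "'a::finite \<Rightarrow> real"
  assumes "\<And>x. f x \<le> 0" "a \<in> X" "f a < 0"
  shows "sum f X < 0"
proof -
  have "sum f X < (\<Sum>x\<in>X. 0)"
    by (intro sum_strict_mono_ex1) (use assms in auto)
  then show ?thesis by simp
qed

text \<open>Farkas' lemma. A functional \<open>a\<close> separating \<open>y\<close> from the closed
  cone of the \<open>h i\<close> is nonnegative on every \<open>h i\<close>, so \<open>- a\<close>
  satisfies all the inequalities while pairing positively with \<open>y\<close>.\<close>

lemma polar_cone_inequalities:
  fixes h :: "'i::finite \<Rightarrow> 'v::euclidean_space"
  shows "polar_cone {x. \<forall>i. h i \<bullet> x \<le> 0} = convex_cone hull range h"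
proof
  have "convex_cone (polar_cone {x. \<forall>i. h i \<bullet> x \<le> 0})"
    unfolding convex_cone_iff polar_cone_def
    by (auto simp: inner_add_left mult_nonneg_nonpos intro: add_nonpos_nonpos)
  then show "convex_cone hull range h \<subseteq> polar_cone {x. \<forall>i. h i \<bullet> x \<le> 0}"
    by (intro hull_minimal) (auto simp: polar_cone_def)
  show "polar_cone {x. \<forall>i. h i \<bullet> x \<le> 0} \<subseteq> convex_cone hull range h"
  proof (rule subsetI, rule ccontr)
    let ?K = "convex_cone hull range h"
    fix y assume y: "y \<in> polar_cone {x. \<forall>i. h i \<bullet> x \<le> 0}" "y \<notin> ?K"
    have "\<exists>a b. a \<bullet> y < b \<and> (\<forall>x\<in>?K. a \<bullet> x > b)"
      using y(2) by (intro separating_hyperplane_closed_point convex_convex_cone_hull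
          closed_convex_cone_hull) auto
    then obtain a b where ab: "a \<bullet> y < b" "\<And>x. x \<in> ?K \<Longrightarrow> b < a \<bullet> x" by blast
    have "b < 0" using ab(2)[OF convex_cone_hull_contains_0] by simp
    have "0 \<le> a \<bullet> h i" for i
    proof (rule ccontr)
      assume "\<not> 0 \<le> a \<bullet> h i"
      \<comment> \<open>This multiple of \<open>h i\<close> has inner product exactly
        \<open>b\<close> with \<open>a\<close>, but points of the cone must exceed
        \<open>b\<close>.\<close>
      moreover then have "(b / (a \<bullet> h i)) *\<^sub>R h i \<in> ?K"
        using \<open>b < 0\<close> by (intro convex_cone_hull_mul) (auto intro: hull_inc simp: divide_nonpos_neg)
      ultimately show False using ab(2) by fastforce
    qed
    then have "- a \<in> {x. \<forall>i. h i \<bullet> x \<le> 0}" by (simp add: inner_commute)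
    then have "y \<bullet> (- a) \<le> 0"
      using y(1) unfolding polar_cone_def by blast
    then show False using ab(1) \<open>b < 0\<close> by (simp add: inner_commute)
  qed
qed

lemma aff_dim_ray:
  fixes w :: "'v::euclidean_space"
  assumes "w \<noteq> 0"
  shows "aff_dim (convex_cone hull {w}) = 1"
proof -
  let ?K = "convex_cone hull {w}"
  have "?K \<subseteq> span {w}"
    by (intro hull_minimal convex_cone_span) (auto intro: span_base)
  then have "span ?K = span {w}"
    by (metis hull_subset span_eq span_mono span_span subset_trans)
  then have "dim ?K = 1"
    using assms by (metis dim_singleton dim_span)
  moreover have "0 \<in> affine hull ?K"
    by (simp add: convex_cone_hull_contains_0 hull_inc)
  ultimately show ?thesis by (simp add: aff_dim_zero)
qed

text \<open>A point of the edge is a positive combination of generators, and an edge containing one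
  positive multiple of a generator contains its whole ray.\<close>

lemma edge_of_cone_subset_ray:
  fixes w :: "'j::finite \<Rightarrow> 'v::euclidean_space"
  assumes T: "T edge_of convex_cone hull range w"
  obtains j where "w j \<noteq> 0" "convex_cone hull {w j} \<subseteq> T"
proof -
  let ?K = "convex_cone hull range w"
  have face: "T face_of ?K" and dim: "aff_dim T = 1" using T by (auto simp: edge_of_def)
  have "\<not> T \<subseteq> {0}"
    using dim aff_dim_subset[of T "{0}"] by auto
  then obtain x where x: "x \<in> T" "x \<noteq> 0" by blast
  then have "x \<in> ?K" using face face_of_imp_subset by blast
  then obtain c where c: "\<And>j. 0 \<le> c j" "x = (\<Sum>j\<in>UNIV. c j *\<^sub>R w j)"
    unfolding convex_cone_hull_range by blast
  have "\<exists>j. c j *\<^sub>R w j \<noteq> 0"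
  proof (rule ccontr)
    assume "\<not> (\<exists>j. c j *\<^sub>R w j \<noteq> 0)"
    then have "x = 0" unfolding c(2) by (intro sum.neutral) auto
    then show False using x by simp
  qed
  then obtain j where j: "c j *\<^sub>R w j \<noteq> 0" by blast
  have mem: "s *\<^sub>R w j \<in> ?K" if "0 \<le> s" for s
    using that by (intro convex_cone_hull_mul hull_inc) auto
  \<comment> \<open>The factor 2 makes \<open>x\<close> the midpoint of two points of the cone, so
    the face takes in both.\<close>
  let ?a = "(2 * c j) *\<^sub>R w j" and ?b = "2 *\<^sub>R (\<Sum>k\<in>UNIV - {j}. c k *\<^sub>R w k)"
  have b: "?b \<in> ?K"
    unfolding convex_cone_hull_range using c
    by (auto intro!: exI[of _ "\<lambda>k. if k = j then 0 else 2 * c k"]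
        simp: sum.remove[of UNIV j] scaleR_sum_right)
  have x_eq: "x = c j *\<^sub>R w j + (\<Sum>k\<in>UNIV - {j}. c k *\<^sub>R w k)"
    unfolding c(2) by (rule sum.remove) auto
  have "?a \<in> T"
  proof (cases "?a = ?b")
    case True
    then have "2 *\<^sub>R x = 2 *\<^sub>R ?a"
      unfolding x_eq by (simp add: scaleR_add_right flip: scaleR_2)
    then have "x = ?a" by (simp only: scaleR_cancel_left) simp
    then show ?thesis using x by simp
  next
    case False
    have "x = (1 - 1/2) *\<^sub>R ?a + (1/2) *\<^sub>R ?b" using x_eq by simp
    then have "x \<in> open_segment ?a ?b"
      using False unfolding in_segment by (intro conjI exI[of _ "1/2::real"]) auto
    then show ?thesis
      using face_ofD[OF face] x b mem[of "2 * c j"] c(1) by simp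
  qed
  define r where "r = 2 * c j"
  have "0 < r" "r *\<^sub>R w j \<in> T" "w j \<noteq> 0"
    using j c(1)[of j] \<open>?a \<in> T\<close> unfolding r_def by auto
  \<comment> \<open>Beyond \<open>r\<close>, the point \<open>r *\<^sub>R w j\<close> is interior to
    the segment from 0 to \<open>s *\<^sub>R w j\<close>, so the face contains both ends; convexity
    then fills in the smaller multiples.\<close>
  have far: "0 \<in> T \<and> s *\<^sub>R w j \<in> T" if "r < s" for s
  proof -
    have "r *\<^sub>R w j \<in> open_segment 0 (s *\<^sub>R w j)"
      unfolding in_segment using that \<open>0 < r\<close> \<open>w j \<noteq> 0\<close>
      by (auto intro!: exI[of _ "r / s"])
    moreover have "s *\<^sub>R w j \<in> ?K" using that \<open>0 < r\<close> by (intro mem) simp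
    ultimately show ?thesis
      using face_ofD[OF face] convex_cone_hull_contains_0 \<open>r *\<^sub>R w j \<in> T\<close> by blast
  qed
  have "s *\<^sub>R w j \<in> T" if "0 \<le> s" for s
  proof -
    have "convex T" using face face_of_imp_convex by blast
    then have "closed_segment 0 ((s + r + 1) *\<^sub>R w j) \<subseteq> T"
      using far[of "s + r + 1"] that by (intro closed_segment_subset) auto
    moreover have "s *\<^sub>R w j \<in> closed_segment 0 ((s + r + 1) *\<^sub>R w j)"
      unfolding in_segment using that \<open>0 < r\<close>
      by (auto intro!: exI[of _ "s / (s + r + 1)"])
    ultimately show ?thesis by blast
  qed
  then have "convex_cone hull {w j} \<subseteq> T"
    unfolding convex_cone_hull_singleton by blast
  then show thesis using that \<open>w j \<noteq> 0\<close> by blast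
qed

section \<open>Facets, rays and facet-ray matrix of the generated cone\<close>

locale irredundant_vectors = full_filled_vectors R d h w
  for R :: "('i::finite \<times> 'j::finite) set" and d
    and h :: "'i \<Rightarrow> 'v::euclidean_space" and w :: "'j \<Rightarrow> 'v" +
  assumes irredundant: "irredundant R"
begin

abbreviation C :: "'v set" where "C \<equiv> convex_cone hull range w"

lemma separating_column: "i \<noteq> k \<Longrightarrow> \<exists>j. (i, j) \<in> R \<and> (k, j) \<notin> R"
  and separating_row: "j \<noteq> l \<Longrightarrow> \<exists>i. (i, j) \<in> R \<and> (i, l) \<notin> R"
  using irredundant unfolding irredundant_def by blast+

lemma h_nonzero: "h i \<noteq> 0" and w_nonzero: "w j \<noteq> 0"
  using row_complement[of i] column_complement[of j] inner_less by fastforce+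

text \<open>A normal supporting the cone exactly along ray j: the facets through this ray contribute
  0 at \<open>w j\<close>, and by irredundancy one of them avoids any given other ray.\<close>

definition exposing_ray where "exposing_ray j = (\<Sum>i | (i, j) \<in> R. h i)"

text \<open>A relative interior point of facet i. Read as a functional, it exposes
  \<open>h i\<close> among the cogenerators.\<close>

definition exposing_facet where "exposing_facet i = (\<Sum>j | (i, j) \<in> R. w j)"

lemma exposing_ray_zero: "exposing_ray j \<bullet> w j = 0"
  unfolding exposing_ray_def by (simp add: inner_sum_left inner_eq)

lemma exposing_facet_zero: "exposing_facet i \<bullet> h i = 0"
  unfolding exposing_facet_def by (simp add: inner_sum_right inner_commute[of _ "h i"] inner_eq)

lemma exposing_ray_neg: "k \<noteq> j \<Longrightarrow> exposing_ray j \<bullet> w k < 0"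
proof -
  assume "k \<noteq> j"
  then obtain i where "(i, j) \<in> R" "(i, k) \<notin> R" using separating_row by metis
  then have "(\<Sum>i | (i, j) \<in> R. h i \<bullet> w k) < 0"
    by (intro sum_neg[of _ i]) (auto simp: inner_le inner_less)
  then show ?thesis by (simp add: exposing_ray_def inner_sum_left)
qed

lemma exposing_facet_neg: "k \<noteq> i \<Longrightarrow> exposing_facet i \<bullet> h k < 0"
proof -
  assume "k \<noteq> i"
  then obtain j where "(i, j) \<in> R" "(k, j) \<notin> R" using separating_column by metis
  then have "(\<Sum>j | (i, j) \<in> R. h k \<bullet> w j) < 0"
    by (intro sum_neg[of _ j]) (auto simp: inner_le inner_less)
  then show ?thesis
    by (simp add: exposing_facet_def inner_sum_right inner_commute[of _ "h k"])
qed

definition center where "center = (\<Sum>j\<in>UNIV. w j)"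

lemma center_neg: "h i \<bullet> center < 0"
proof -
  obtain j where "(i, j) \<notin> R" using row_complement by blast
  then have "(\<Sum>j\<in>UNIV. h i \<bullet> w j) < 0"
    by (intro sum_neg[of _ j]) (auto simp: inner_le inner_less)
  then show ?thesis by (simp add: center_def inner_sum_right)
qed

lemma interior_cone: "interior C \<noteq> {}"
proof -
  have "open (\<Inter>i. {x. h i \<bullet> x < 0})"
    by (intro open_INT) (auto simp: open_halfspace_lt)
  moreover have "(\<Inter>i. {x. h i \<bullet> x < 0}) \<subseteq> C"
    unfolding cone_eq by (auto simp: less_imp_le)
  ultimately have "(\<Inter>i. {x. h i \<bullet> x < 0}) \<subseteq> interior C" by (rule interior_maximal[rotated])
  then show ?thesis using center_neg by blast
qed

text \<open>Such a \<open>u\<close> lies in the cone, where the sum of all \<open>h i\<close> is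
  negative except at 0. Besides pointedness, this gives injectivity of the map to slack
  coordinates.\<close>

lemma eq_zero_if_orthogonal:
  assumes "\<And>i. h i \<bullet> u = 0"
  shows "u = 0"
proof -
  have "(\<Sum>i\<in>UNIV. h i) \<bullet> w j < 0" for j
  proof -
    obtain i where "(i, j) \<notin> R" using column_complement by blast
    then have "(\<Sum>i\<in>UNIV. h i \<bullet> w j) < 0"
      by (intro sum_neg[of _ i]) (auto simp: inner_le inner_less)
    then show ?thesis by (simp add: inner_sum_left)
  qed
  moreover have "u \<in> C" using assms by (simp add: cone_eq)
  ultimately have "u = 0 \<or> (\<Sum>i\<in>UNIV. h i) \<bullet> u < 0"
    by (intro convex_cone_hull_neg[of "range w"]) auto
  then show ?thesis using assms by (simp add: inner_sum_left)
qed

lemma pointed_cone: "pointed_cone C"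
  unfolding pointed_cone_def
proof (intro conjI notI)
  show "\<exists>S. finite S \<and> C = convex_cone hull S"
    by (intro exI[of _ "range w"]) auto
  assume "\<exists>a u. u \<noteq> 0 \<and> (\<forall>t. a + t *\<^sub>R u \<in> C)"
  then obtain a u where "u \<noteq> 0" and line: "\<And>t i. h i \<bullet> a + t * (h i \<bullet> u) \<le> 0"
    unfolding cone_eq by (auto simp: inner_add_right)
  have "h i \<bullet> u = 0" for i
  proof (rule ccontr)
    assume "h i \<bullet> u \<noteq> 0"
    then have "h i \<bullet> a + ((1 - h i \<bullet> a) / (h i \<bullet> u)) * (h i \<bullet> u) = 1" by simp
    then show False using line[of i "(1 - h i \<bullet> a) / (h i \<bullet> u)"] by linarith
  qed
  then show False using \<open>u \<noteq> 0\<close> eq_zero_if_orthogonal by blast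
qed

text \<open>If the columns of row i spanned less, a flag through their maxbiclique would have a
  member one dimension higher that is not yet the top and so keeps some row k. Row k then contains
  row i, so k = i by irredundancy, and the higher member has no further column.\<close>

lemma dim_facet: "dim (w ` {j. (i, j) \<in> R}) = d"
proof -
  obtain p where p: "p \<in> L" "snd p = {j. (i, j) \<in> R}"
    using maxbiclique_of_rows[of "{i}" R] by fastforce
  have "snd p \<subset> UNIV" using p row_complement by blast
  then have "D p < D ({}, UNIV)" using D_less[OF p(1) top_mem] by simp
  then have "D p \<le> d" using dim_range by (simp add: D_def)
  moreover have "\<not> D p < d"
  proof
    assume less: "D p < d"
    obtain F where F: "F \<in> flags L biclique_le" "p \<in> F"
      using flag_extend[of "{p}"] p by auto
    have "D p + 1 \<in> D ` F" using less D_image_flag[OF F(1)] by auto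
    then obtain r where r: "r \<in> F" "D r = D p + 1" by auto
    then have "r \<in> L" using flagD[OF F(1)] by blast
    have "fst r \<noteq> {}"
    proof
      assume "fst r = {}"
      then have "snd r = UNIV" using maxbiclique_column[OF \<open>r \<in> L\<close>] by auto
      then show False using r less dim_range by (simp add: D_def)
    qed
    then obtain k where k: "k \<in> fst r" by blast
    have "snd p \<subseteq> snd r"
      using flagD(2)[OF F(1) F(2) r(1)] D_mono[of r p] r(2) by auto
    then have "{j. (i, j) \<in> R} \<subseteq> {j. (k, j) \<in> R}"
      using p k maxbiclique_mem[OF \<open>r \<in> L\<close>] by blast
    then have "i = k" using separating_column by blast
    then have "snd r \<subseteq> snd p" using p k maxbiclique_mem[OF \<open>r \<in> L\<close>] by blast
    then show False using D_mono[of r p] r by simp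
  qed
  ultimately show ?thesis using p by (simp add: D_def)
qed

text \<open>Moving from the relative interior of facet i a little away from \<open>center\<close>
  violates inequality i alone, since the others are strict at the start. The bound
  \<open>\<epsilon>\<close> on the step lets the polytope version keep the last coordinate
  positive.\<close>

lemma beyond_one_facet:
  assumes "0 < \<epsilon>"
  obtains e where "0 < e" "e \<le> \<epsilon>" "0 < h i \<bullet> (exposing_facet i - e *\<^sub>R center)"
    "\<And>k. k \<noteq> i \<Longrightarrow> h k \<bullet> (exposing_facet i - e *\<^sub>R center) \<le> 0"
proof -
  define e where "e = Min (insert \<epsilon> ((\<lambda>k. (exposing_facet i \<bullet> h k) / (center \<bullet> h k)) ` (- {i})))"
  have e_le: "e \<le> (exposing_facet i \<bullet> h k) / (center \<bullet> h k)" if "k \<noteq> i" for k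
    unfolding e_def using that by (intro Min_le) auto
  have "0 < e"
    unfolding e_def using exposing_facet_neg center_neg assms
    by (subst Min_gr_iff) (auto simp: inner_commute divide_neg_neg)
  moreover have "e \<le> \<epsilon>" unfolding e_def by (intro Min_le) auto
  moreover have "h k \<bullet> (exposing_facet i - e *\<^sub>R center) \<le> 0" if "k \<noteq> i" for k
    using e_le[OF that] center_neg[of k]
    by (simp add: inner_diff_right inner_commute neg_le_divide_eq)
  moreover have "0 < h i \<bullet> (exposing_facet i - e *\<^sub>R center)"
    using \<open>0 < e\<close> exposing_facet_zero[of i] center_neg[of i]
    by (simp add: inner_diff_right inner_commute mult_pos_neg)
  ultimately show thesis using that by blast
qed

lemma facet_of_cone_iff: "T facet_of C \<longleftrightarrow> (\<exists>i. T = {x \<in> C. h i \<bullet> x = 0})"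
proof -
  have "T facet_of C \<longleftrightarrow> (\<exists>i. T = C \<inter> {x. h i \<bullet> x = 0})"
  proof (rule facet_of_irredundant_polyhedron[where b = "\<lambda>_. 0"])
    show "\<exists>x. 0 < h i \<bullet> x \<and> (\<forall>k. k \<noteq> i \<longrightarrow> h k \<bullet> x \<le> 0)" for i
      using beyond_one_facet[of 1 i] by (metis zero_less_one)
  qed (rule cone_eq interior_cone h_nonzero)+
  moreover have "C \<inter> {x. h i \<bullet> x = 0} = {x \<in> C. h i \<bullet> x = 0}" for i by blast
  ultimately show ?thesis by simp
qed

lemma ray_edge_of: "convex_cone hull {w j} edge_of C"
proof -
  have "exposing_ray j \<bullet> x \<le> 0" if "x \<in> C" for x
    unfolding exposing_ray_def using that by (auto simp: cone_eq inner_sum_left intro!: sum_nonpos)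
  then have "C \<inter> {x. exposing_ray j \<bullet> x = 0} face_of C"
    by (intro face_of_Int_supporting_hyperplane_le convex_convex_cone_hull)
  moreover have "convex_cone hull {w j} = C \<inter> {x. exposing_ray j \<bullet> x = 0}"
    using exposing_ray_zero exposing_ray_neg by (rule convex_cone_hull_exposed)
  ultimately show ?thesis
    using aff_dim_ray[OF w_nonzero, of j] by (simp add: edge_of_def)
qed

lemma edge_of_cone_iff: "T edge_of C \<longleftrightarrow> (\<exists>j. T = convex_cone hull {w j})"
proof
  assume T: "T edge_of C"
  then obtain j where j: "convex_cone hull {w j} \<subseteq> T"
    using edge_of_cone_subset_ray by blast
  have T': "T face_of C" "aff_dim T = 1"
    using T by (auto simp: edge_of_def)
  have "convex_cone hull {w j} face_of T"
    using face_of_subset[OF _ j face_of_imp_subset[OF T'(1)]] ray_edge_of[of j]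
    by (simp add: edge_of_def)
  moreover have "aff_dim (convex_cone hull {w j}) = aff_dim T"
    using aff_dim_ray[OF w_nonzero] T'(2) by simp
  ultimately have "convex_cone hull {w j} = T"
    using face_of_aff_dim_lt[OF face_of_imp_convex[OF T'(1)]] by (metis less_irrefl)
  then show "\<exists>j. T = convex_cone hull {w j}" by blast
qed (use ray_edge_of in blast)

lemma ray_subset_facet_iff:
  "convex_cone hull {w j} \<subseteq> {x \<in> C. h i \<bullet> x = 0} \<longleftrightarrow> (i, j) \<in> R"
proof -
  have "convex_cone hull {w j} \<subseteq> C" by (intro hull_mono) auto
  moreover have "w j \<in> convex_cone hull {w j}" by (simp add: hull_inc)
  ultimately show ?thesis
    using inner_zero_iff[of i j] by (auto simp: convex_cone_hull_singleton)
qed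

lemma inj_facets: "inj (\<lambda>i. {x \<in> C. h i \<bullet> x = 0})"
proof
  fix i k assume eq: "{x \<in> C. h i \<bullet> x = 0} = {x \<in> C. h k \<bullet> x = 0}"
  have "(i, j) \<in> R \<longleftrightarrow> (k, j) \<in> R" for j
    by (simp only: ray_subset_facet_iff[symmetric] eq)
  then show "i = k" using separating_column by metis
qed

lemma inj_rays: "inj (\<lambda>j. convex_cone hull {w j})"
proof
  fix j k assume eq: "convex_cone hull {w j} = convex_cone hull {w k}"
  have "(i, j) \<in> R \<longleftrightarrow> (i, k) \<in> R" for i
    by (simp only: ray_subset_facet_iff[symmetric] eq)
  then show "j = k" using separating_row by metis
qed

theorem type_cone: "type_cone R C (\<lambda>i. {x \<in> C. h i \<bullet> x = 0}) (\<lambda>j. convex_cone hull {w j})"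
  unfolding type_cone_def bij_betw_def
  using pointed_cone inj_facets inj_rays ray_subset_facet_iff facet_of_cone_iff edge_of_cone_iff
  by auto

text \<open>Both generating families are minimal by the same criterion; for the polar cone, Farkas'
  lemma swaps the roles of \<open>h\<close> and \<open>w\<close>.\<close>

theorem facet_ray_matrix:
  "facet_ray_matrix C (\<lambda>i. {x \<in> C. h i \<bullet> x = 0}) (\<lambda>j. convex_cone hull {w j})
     (\<chi> i j. h i \<bullet> w j)"
proof -
  have "generators (range w) C"
    using w_nonzero exposing_ray_zero exposing_ray_neg by (rule generators_range)
  moreover have "generators (range h) (polar_cone C)"
    unfolding cone_eq polar_cone_inequalities
    using h_nonzero exposing_facet_zero exposing_facet_neg by (rule generators_range)
  ultimately show ?thesis
    unfolding facet_ray_matrix_def using pointed_cone interior_cone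
    by (auto intro!: exI[of _ h] exI[of _ w])
qed

end

section \<open>Filled incidence matrices\<close>

lemma rank_inner_matrix_le:
  fixes h :: "'i::finite \<Rightarrow> 'v::euclidean_space" and w :: "'j::finite \<Rightarrow> 'v"
  shows "rank (\<chi> i j. h i \<bullet> w j) \<le> DIM('v)"
proof -
  let ?f = "\<lambda>x. \<chi> i. h i \<bullet> x"
  have "linear ?f" by (rule linearI) (simp_all add: vec_eq_iff inner_add_right)
  moreover have "columns (\<chi> i j. h i \<bullet> w j) = ?f ` range w"
    by (auto simp: columns_def column_def vec_eq_iff)
  ultimately have "rank (\<chi> i j. h i \<bullet> w j) \<le> dim (range w)"
    by (simp add: column_rank_def dim_image_le)
  also have "\<dots> \<le> DIM('v)" by (rule dim_subset_UNIV)
  finally show ?thesis .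
qed

text \<open>The column space is moved isometrically into the target by \<open>f\<close>, with a
  linear left inverse \<open>g\<close> on it. Then \<open>w j\<close> is the image of column j, and
  \<open>h i\<close> is the i-th coordinate functional pulled back along \<open>g\<close>.\<close>

lemma rank_factorization:
  fixes N :: "real^'j::finite^'i::finite"
  assumes "rank N \<le> DIM('v::euclidean_space)"
  obtains h :: "'i \<Rightarrow> 'v::euclidean_space" and w :: "'j \<Rightarrow> 'v" where "\<And>i j. N $ i $ j = h i \<bullet> w j"
proof -
  let ?S = "span (columns N)"
  have "dim ?S \<le> dim (UNIV :: 'v set)"
    using assms by (simp add: column_rank_def)
  then obtain f :: "real^'i \<Rightarrow> 'v" where f: "linear f" "\<And>x. x \<in> ?S \<Longrightarrow> norm (f x) = norm x"
    using isometry_subset_subspace[OF subspace_span subspace_UNIV, of "columns N"] by metis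
  have "inj_on f ?S"
  proof (rule inj_onI)
    fix x y assume "x \<in> ?S" "y \<in> ?S" "f x = f y"
    then have "norm (x - y) = 0"
      using f(2)[of "x - y"] by (simp add: span_diff linear_diff[OF f(1)])
    then show "x = y" by simp
  qed
  then obtain g where g: "linear g" "\<And>x. x \<in> ?S \<Longrightarrow> g (f x) = x"
    using linear_exists_left_inverse_on[OF f(1) subspace_span] by blast
  have "N $ i $ j = adjoint g (axis i 1) \<bullet> f (column j N)" for i j
  proof -
    have "column j N \<in> ?S" by (intro span_base) (auto simp: columns_def)
    have "adjoint g (axis i 1) \<bullet> f (column j N) = axis i 1 \<bullet> g (f (column j N))"
      using adjoint_works[OF g(1)] by (simp add: inner_commute)
    also have "\<dots> = N $ i $ j"
      unfolding g(2)[OF \<open>column j N \<in> ?S\<close>] by (simp add: inner_axis' column_def)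
    finally show ?thesis by simp
  qed
  then show thesis by (rule that)
qed

section \<open>Positive row and column scalings\<close>

definition diag :: "('n \<Rightarrow> real) \<Rightarrow> real^'n^'n" where
  "diag s = (\<chi> i j. if i = j then s i else 0)"

definition rescale :: "('i \<Rightarrow> real) \<Rightarrow> ('j \<Rightarrow> real) \<Rightarrow> real^'j^'i \<Rightarrow> real^'j^'i" where
  "rescale s t N = (\<chi> i j. s i * N $ i $ j * t j)"

lemma rescale_nth [simp]: "rescale s t N $ i $ j = s i * N $ i $ j * t j"
  by (simp add: rescale_def)

lemma diag_mult:
  fixes N :: "real^'j::finite^'i::finite"
  shows "diag s ** N ** diag t = rescale s t N"
  by (simp add: vec_eq_iff matrix_matrix_mult_def diag_def if_distrib[of "\<lambda>x. _ * x"]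
      if_distrib[of "\<lambda>x. x * _"] cong: if_cong)

lemma positive_diagonal_iff: "positive_diagonal D \<longleftrightarrow> (\<exists>s. (\<forall>i. 0 < s i) \<and> D = diag s)"
proof
  assume D: "positive_diagonal D"
  then have "D = diag (\<lambda>i. D $ i $ i)"
    unfolding positive_diagonal_def diag_def vec_eq_iff by simp
  then show "\<exists>s. (\<forall>i. 0 < s i) \<and> D = diag s"
    using D by (intro exI[of _ "\<lambda>i. D $ i $ i"]) (simp add: positive_diagonal_def)
qed (auto simp: positive_diagonal_def diag_def)

lemma scaling_rel_iff:
  "(N, N') \<in> scaling_rel S \<longleftrightarrow>
     N \<in> S \<and> N' \<in> S \<and> (\<exists>s t. (\<forall>i. 0 < s i) \<and> (\<forall>j. 0 < t j) \<and> N' = rescale s t N)"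
proof -
  have "(\<exists>D1 D2. positive_diagonal D1 \<and> positive_diagonal D2 \<and> N' = D1 ** N ** D2) \<longleftrightarrow>
      (\<exists>s t. (\<forall>i. 0 < s i) \<and> (\<forall>j. 0 < t j) \<and> N' = diag s ** N ** diag t)"
    unfolding positive_diagonal_iff by blast
  then show ?thesis
    unfolding diag_mult by (simp add: scaling_rel_def)
qed

lemma rank_rescale_le:
  fixes N :: "real^'j::finite^'i::finite"
  shows "rank (rescale s t N) \<le> rank N"
  unfolding diag_mult[symmetric]
  by (meson order_trans rank_mul_le_left rank_mul_le_right)

lemma rank_rescale:
  fixes N :: "real^'j::finite^'i::finite"
  assumes "\<And>i. 0 < s i" "\<And>j. 0 < t j"
  shows "rank (rescale s t N) = rank N"
proof (rule antisym)
  have "s i \<noteq> 0" "t j \<noteq> 0" for i j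
    using assms by (metis less_irrefl)+
  then have "rescale (\<lambda>i. 1 / s i) (\<lambda>j. 1 / t j) (rescale s t N) = N"
    by (simp add: vec_eq_iff)
  then show "rank N \<le> rank (rescale s t N)"
    by (metis rank_rescale_le)
qed (rule rank_rescale_le)

lemma filled_incidence_rescale:
  assumes "\<And>i. 0 < s i" "\<And>j. 0 < t j" "filled_incidence 0 R N"
  shows "filled_incidence 0 R (rescale s t N)"
  using assms unfolding filled_incidence_def
  by (auto simp: mult_less_0_iff zero_less_mult_iff split: if_splits)

lemma equiv_scaling_rel: "equiv S (scaling_rel S)"
proof (rule equivI)
  show "scaling_rel S \<subseteq> S \<times> S" by (auto simp: scaling_rel_def)
  show "refl_on S (scaling_rel S)"
    by (rule refl_onI) (auto simp: scaling_rel_iff vec_eq_iff intro!: exI[of _ "\<lambda>_. 1"])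
  show "sym (scaling_rel S)"
  proof (rule symI)
    fix N N' assume "(N, N') \<in> scaling_rel S"
    then obtain s t where st: "N \<in> S" "N' \<in> S" "\<And>i. 0 < s i" "\<And>j. 0 < t j" "N' = rescale s t N"
      by (auto simp: scaling_rel_iff)
    have "s i \<noteq> 0" "t j \<noteq> 0" for i j
      using st by (metis less_irrefl)+
    then have "N = rescale (\<lambda>i. 1 / s i) (\<lambda>j. 1 / t j) N'"
      by (simp add: vec_eq_iff st(5))
    moreover have "\<forall>i. 0 < 1 / s i" "\<forall>j. 0 < 1 / t j" using st by auto
    ultimately have "\<exists>s t. (\<forall>i. 0 < s i) \<and> (\<forall>j. 0 < t j) \<and> N = rescale s t N'"
      by (intro exI conjI)
    then show "(N', N) \<in> scaling_rel S"
      using st(1,2) by (simp add: scaling_rel_iff)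
  qed
  show "trans (scaling_rel S)"
  proof (rule transI)
    fix N N' N'' assume "(N, N') \<in> scaling_rel S" "(N', N'') \<in> scaling_rel S"
    then obtain s t s' t' where st: "N \<in> S" "N'' \<in> S" "\<And>i. 0 < s i" "\<And>j. 0 < t j"
      "\<And>i. 0 < s' i" "\<And>j. 0 < t' j" "N'' = rescale s' t' (rescale s t N)"
      by (auto simp: scaling_rel_iff)
    have "N'' = rescale (\<lambda>i. s' i * s i) (\<lambda>j. t j * t' j) N"
      by (simp add: vec_eq_iff st(7))
    moreover have "\<forall>i. 0 < s' i * s i" "\<forall>j. 0 < t j * t' j" using st by auto
    ultimately have "\<exists>s t. (\<forall>i. 0 < s i) \<and> (\<forall>j. 0 < t j) \<and> N'' = rescale s t N"
      by (intro exI conjI)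
    then show "(N, N'') \<in> scaling_rel S"
      using st(1,2) by (simp add: scaling_rel_iff)
  qed
qed

section \<open>Rank-one changes and the two rank conditions\<close>

lemma rank_add_rank_one:
  fixes M N :: "real^'j::finite^'i::finite"
  assumes "\<And>i j. N $ i $ j = M $ i $ j + a i * b j"
  shows "rank N \<le> rank M + 1"
proof -
  let ?a = "\<chi> i. a i"
  have "columns N \<subseteq> span (insert ?a (columns M))"
  proof
    fix x assume "x \<in> columns N"
    then obtain j where "x = column j N" by (auto simp: columns_def)
    then have "x = column j M + b j *\<^sub>R ?a"
      by (simp add: vec_eq_iff column_def assms)
    moreover have "column j M \<in> columns M" by (auto simp: columns_def)
    ultimately show "x \<in> span (insert ?a (columns M))"
      by (auto intro!: span_add span_scale intro: span_base)
  qed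
  then have "dim (columns N) \<le> dim (insert ?a (columns M))"
    by (metis dim_span dim_subset)
  then show ?thesis by (auto simp: column_rank_def dim_insert split: if_splits)
qed

text \<open>Subtracting from \<open>N\<close> the product of its row sums and column sums, divided by the total sum,
  makes all column sums zero and so lowers the rank; a rescaling turns this rank one matrix into the
  constant \<open>-1\<close>.\<close>

lemma rescaled_filled1_rank:
  fixes N :: "real^'j::finite^'i::finite"
  assumes N: "filled_incidence 0 R N" and R: "nondegenerate R"
  obtains s t where "\<And>i. 0 < s i" "\<And>j. 0 < t j" "rank (\<chi> i j. rescale s t N $ i $ j + 1) + 1 = rank N"
proof -
  define r where "r i = - (\<Sum>j\<in>UNIV. N $ i $ j)" for i
  define c where "c j = - (\<Sum>i\<in>UNIV. N $ i $ j)" for j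
  define \<sigma> where "\<sigma> = (\<Sum>i\<in>UNIV. r i)"
  have le: "N $ i $ j \<le> 0" and less: "(i, j) \<notin> R \<Longrightarrow> N $ i $ j < 0" for i j
    using N unfolding filled_incidence_def by (metis less_imp_le order_refl)+
  have r: "0 < r i" for i
  proof -
    obtain j where "(i, j) \<notin> R" using R by (auto simp: nondegenerate_def)
    then show ?thesis using sum_neg[OF le UNIV_I less] by (simp add: r_def)
  qed
  have c: "0 < c j" for j
  proof -
    obtain i where "(i, j) \<notin> R" using R by (auto simp: nondegenerate_def)
    then show ?thesis using sum_neg[OF le UNIV_I less] by (simp add: c_def)
  qed
  have \<sigma>: "0 < \<sigma>" unfolding \<sigma>_def using r by (intro sum_pos) auto
  \<comment> \<open>With these factors the entry \<open>r i * c j / \<sigma>\<close> of the rank-one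
    correction is rescaled to 1.\<close>
  define s where "s i = \<sigma> / r i" for i
  define t where "t j = 1 / c j" for j
  have s: "0 < s i" and t: "0 < t j" for i j using r c \<sigma> by (auto simp: s_def t_def)
  define M where "M = (\<chi> i j. rescale s t N $ i $ j + 1)"
  define M0 where "M0 = (\<chi> i j. N $ i $ j + r i * c j / \<sigma>)"
  have ne: "r i \<noteq> 0" "c j \<noteq> 0" "\<sigma> \<noteq> 0" for i j
    using r[of i] c[of j] \<sigma> by auto
  have "M = rescale s t M0"
    using ne by (simp add: vec_eq_iff M_def M0_def s_def t_def field_simps)
  then have "rank M = rank M0" using rank_rescale s t by metis
  moreover have "rank M0 < rank N"
  proof -
    \<comment> \<open>The columns of \<open>M0\<close> lie in the column space of \<open>N\<close>
      and in the hyperplane of coordinate sum 0, which contains no column of \<open>N\<close>; so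
      the column space shrinks strictly.\<close>
    let ?S = "span (columns N)" and ?K = "{x. (1 :: real^'i) \<bullet> x = 0}"
    have col: "column j M0 = column j N - (c j / \<sigma>) *\<^sub>R (\<Sum>k\<in>UNIV. column k N)" for j
      by (simp add: vec_eq_iff column_def M0_def r_def)
    have mem: "column k N \<in> columns N" for k by (auto simp: columns_def)
    have "columns M0 \<subseteq> ?S"
    proof
      fix x assume "x \<in> columns M0"
      then obtain j where "x = column j M0" by (auto simp: columns_def)
      then show "x \<in> ?S"
        unfolding \<open>x = column j M0\<close> col
        by (intro span_diff span_scale span_sum span_base mem)
    qed
    moreover have "columns M0 \<subseteq> ?K"
    proof
      fix x assume "x \<in> columns M0"
      then obtain j where "x = column j M0" by (auto simp: columns_def)
      then have "1 \<bullet> x = (\<Sum>i\<in>UNIV. N $ i $ j) + (\<Sum>i\<in>UNIV. r i) * c j / \<sigma>"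
        by (simp add: inner_vec_def column_def M0_def sum.distrib sum_distrib_right
            sum_divide_distrib)
      also have "\<dots> = 0" using \<sigma> by (simp add: \<sigma>_def[symmetric] c_def)
      finally show "x \<in> ?K" by simp
    qed
    ultimately have "span (columns M0) \<subseteq> ?S" "span (columns M0) \<subseteq> ?K"
      by (simp_all add: span_minimal subspace_hyperplane)
    moreover have "column j N \<notin> ?K" for j
    proof -
      have "(1 :: real^'i) \<bullet> column j N = - c j"
        by (simp add: inner_vec_def column_def c_def)
      then show ?thesis using ne(2)[of j] by simp
    qed
    ultimately have "span (columns M0) \<subset> ?S"
      using span_base[OF mem] by blast
    then show ?thesis
      by (simp add: column_rank_def dim_psubset)
  qed
  moreover have "rank N \<le> rank M + 1"
  proof -
    have "rank (rescale s t N) \<le> rank M + 1"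
      by (rule rank_add_rank_one[where a = "\<lambda>_. -1" and b = "\<lambda>_. 1"]) (simp add: M_def)
    then show ?thesis using rank_rescale s t by metis
  qed
  ultimately have "rank M + 1 = rank N" by simp
  then show thesis using that s t unfolding M_def by blast
qed

text \<open>Subtracting 1 from all entries raises the rank by at most one, and d + 1 is the least
  rank possible for the result. Conversely, positive scalings keep the filled pattern, so 1 can be
  added after the rank-lowering rescaling.\<close>

lemma (in diamond_relation) filled1_iff_filled0:
  "(\<exists>M :: real^'j^'i. filled_incidence 1 R M \<and> rank M = d) \<longleftrightarrow>
   (\<exists>N :: real^'j^'i. filled_incidence 0 R N \<and> rank N = d + 1)"
proof
  assume "\<exists>M :: real^'j^'i. filled_incidence 1 R M \<and> rank M = d"
  then obtain M :: "real^'j^'i" where M: "filled_incidence 1 R M" "rank M = d" by blast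
  let ?N = "\<chi> i j. M $ i $ j - 1"
  have N: "filled_incidence 0 R ?N"
    using M(1) by (auto simp: filled_incidence_def split: if_splits)
  have "rank ?N \<le> rank M + 1"
    by (rule rank_add_rank_one[where a = "\<lambda>_. -1" and b = "\<lambda>_. 1"]) simp
  then have "rank ?N = d + 1" using rank_ge[OF N] M(2) by simp
  then show "\<exists>N :: real^'j^'i. filled_incidence 0 R N \<and> rank N = d + 1" using N by blast
next
  assume "\<exists>N :: real^'j^'i. filled_incidence 0 R N \<and> rank N = d + 1"
  then obtain N :: "real^'j^'i" where N: "filled_incidence 0 R N" "rank N = d + 1" by blast
  obtain s t where st: "\<And>i. 0 < s i" "\<And>j. 0 < t j"
    "rank (\<chi> i j. rescale s t N $ i $ j + 1) + 1 = rank N"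
    using rescaled_filled1_rank[OF N(1) nondegenerate] by blast
  have "filled_incidence 1 R (\<chi> i j. rescale s t N $ i $ j + 1)"
    using filled_incidence_rescale[OF st(1,2) N(1)]
    by (auto simp: filled_incidence_def simp del: rescale_nth split: if_splits)
  moreover have "rank (\<chi> i j. rescale s t N $ i $ j + 1) = d" using st(3) N(2) by simp
  ultimately show "\<exists>M :: real^'j^'i. filled_incidence 1 R M \<and> rank M = d" by blast
qed

section \<open>Type cones\<close>

locale irredundant_relation = diamond_relation R d for R :: "('i::finite \<times> 'j::finite) set" and d +
  assumes irredundant: "irredundant R"
begin

lemma irredundant_vectors:
  fixes h :: "'i \<Rightarrow> 'v::euclidean_space"
  assumes "DIM('v) = d + 1" "filled_incidence 0 R N" "\<And>i j. N $ i $ j = h i \<bullet> w j"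
  shows "irredundant_vectors R d h w"
  by unfold_locales
    (use assms irredundant in \<open>auto simp: filled_incidence_def split: if_splits\<close>)

lemma filled0_matrices_if_rank_le:
  "filled_incidence 0 R N \<Longrightarrow> rank N \<le> d + 1 \<Longrightarrow> N \<in> filled0_matrices R (d + 1)"
  using rank_ge by (simp add: filled0_matrices_def le_antisym)

lemma type_cone_facet_ray_matrix_iff:
  fixes N :: "real^'j^'i"
  assumes "DIM('v::euclidean_space) = d + 1"
  shows "(\<exists>(C :: 'v::euclidean_space set) F E. type_cone R C F E \<and> facet_ray_matrix C F E N) \<longleftrightarrow>
    filled_incidence 0 R N \<and> rank N = d + 1"
proof
  assume "\<exists>(C :: 'v set) F E. type_cone R C F E \<and> facet_ray_matrix C F E N"
  then obtain C :: "'v set" and F E where type: "type_cone R C F E" and "facet_ray_matrix C F E N"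
    by blast
  then obtain h w where "generators (range w) C \<and> (\<forall>j. E j = convex_cone hull {w j}) \<and>
      generators (range h) (polar_cone C) \<and> (\<forall>i. F i = {x \<in> C. h i \<bullet> x = 0}) \<and>
      (\<forall>i j. N $ i $ j = h i \<bullet> w j)"
    unfolding facet_ray_matrix_def by (elim conjE exE) (rule that, intro conjI)
  then have hw: "convex_cone hull range w = C" "\<And>j. E j = convex_cone hull {w j}"
    "convex_cone hull range h = polar_cone C" "\<And>i. F i = {x \<in> C. h i \<bullet> x = 0}"
    "\<And>i j. N $ i $ j = h i \<bullet> w j"
    unfolding generators_def by simp_all
  have w: "w j \<in> C" for j using hw(1) by (metis hull_inc rangeI)
  have "h i \<in> polar_cone C" for i using hw(3) by (metis hull_inc rangeI)
  then have le: "N $ i $ j \<le> 0" for i j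
    using w hw(5) by (simp add: polar_cone_def)
  have ER: "E j \<subseteq> F i \<longleftrightarrow> (i, j) \<in> R" for i j
    using type by (simp add: type_cone_def)
  have "E j \<subseteq> F i \<longleftrightarrow> h i \<bullet> w j = 0" for i j
  proof
    assume "E j \<subseteq> F i"
    moreover have "w j \<in> E j" by (simp add: hw(2) hull_inc)
    ultimately show "h i \<bullet> w j = 0" using hw(4) by blast
  next
    assume "h i \<bullet> w j = 0"
    moreover have "E j \<subseteq> C" unfolding hw(1)[symmetric] hw(2) by (intro hull_mono) auto
    ultimately show "E j \<subseteq> F i"
      by (auto simp: hw(2,4) convex_cone_hull_singleton)
  qed
  then have zero: "N $ i $ j = 0 \<longleftrightarrow> (i, j) \<in> R" for i j
    using ER hw(5) by simp
  then have "filled_incidence 0 R N"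
    using le unfolding filled_incidence_def by (auto simp: less_le)
  moreover have "N = (\<chi> i j. h i \<bullet> w j)" by (simp add: vec_eq_iff hw(5))
  then have "rank N \<le> d + 1" using rank_inner_matrix_le[of h w] assms by simp
  ultimately show "filled_incidence 0 R N \<and> rank N = d + 1"
    using rank_ge by (simp add: le_antisym)
next
  assume N: "filled_incidence 0 R N \<and> rank N = d + 1"
  then obtain h :: "'i \<Rightarrow> 'v" and w where hw: "\<And>i j. N $ i $ j = h i \<bullet> w j"
    using rank_factorization[of N, where ?'v = 'v] assms by auto
  then interpret irredundant_vectors R d h w
    using N assms by (intro irredundant_vectors) auto
  have "N = (\<chi> i j. h i \<bullet> w j)" by (simp add: vec_eq_iff hw)
  then show "\<exists>(C :: 'v set) F E. type_cone R C F E \<and> facet_ray_matrix C F E N"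
    using type_cone facet_ray_matrix by blast
qed

text \<open>No coordinate type has \<open>CARD('d) = 0\<close>, so for d = 0 the moduli space is
  identified as a point on the matrix side. A flag has two elements, leaving no room for the
  maxbiclique of a row with a related column. So \<open>R\<close> is empty, irredundancy leaves one
  row and one column, and a negative number is unique up to positive scaling.\<close>

lemma is_singleton_moduli:
  assumes "d = 0"
  shows "is_singleton (filled0_matrices R (d + 1) // scaling_rel (filled0_matrices R (d + 1)))"
proof -
  let ?B = "filled0_matrices R (d + 1)"
  have empty: "(i, j) \<notin> R" for i j
  proof
    assume "(i, j) \<in> R"
    obtain p where p: "p \<in> maxbicliques R" "snd p = {j. (i, j) \<in> R}"
      using maxbiclique_of_rows[of "{i}" R] by fastforce
    have ne: "snd p \<noteq> {}" "snd p \<noteq> UNIV"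
      using p \<open>(i, j) \<in> R\<close> row_complement[of i] by auto
    have "card {(UNIV, {}), p, ({}, UNIV)} \<le> d + 2"
    proof (rule chain_card_le)
      show "{(UNIV, {}), p, ({}, UNIV)} \<subseteq> maxbicliques R"
        using p(1) top_mem bot_mem by simp
      fix x y assume "x \<in> {(UNIV, {}), p, ({}, UNIV)}" "y \<in> {(UNIV, {}), p, ({}, UNIV)}"
      then have "snd x \<in> {{}, snd p, UNIV}" "snd y \<in> {{}, snd p, UNIV}" by auto
      then show "snd x \<subseteq> snd y \<or> snd y \<subseteq> snd x" by blast
    qed
    moreover have "p \<noteq> (UNIV, {})" "p \<noteq> ({}, UNIV)"
      using ne by auto
    ultimately show False using assms by auto
  qed
  have i: "i = i'" and j: "j = j'" for i i' :: 'i and j j' :: 'j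
    using irredundant empty by (auto simp: irredundant_def)
  have filled: "filled_incidence 0 R N \<longleftrightarrow> (\<forall>i j. N $ i $ j < 0)" for N :: "real^'j^'i"
    using empty by (auto simp: filled_incidence_def)
  define N :: "real^'j^'i" where "N = (\<chi> i j. -1)"
  have "UNIV = {undefined :: 'i}" using i by blast
  then have "CARD('i) = 1" by (metis card_1_singleton_iff One_nat_def)
  then have "rank N \<le> d + 1" using rank_bound[of N] assms by simp
  then have N: "N \<in> ?B"
    by (intro filled0_matrices_if_rank_le) (auto simp: filled N_def)
  have "(N, M) \<in> scaling_rel ?B" if M: "M \<in> ?B" for M
  proof -
    have "M $ i $ j < 0" for i j using M filled by (simp add: filled0_matrices_def)
    moreover have "M = rescale (\<lambda>i. - (M $ i $ undefined)) (\<lambda>_. 1) N"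
      by (simp add: vec_eq_iff N_def) (metis j)
    ultimately show ?thesis
      unfolding scaling_rel_iff using N M
      by (metis neg_0_less_iff_less zero_less_one)
  qed
  then have "K = scaling_rel ?B `` {N}" if "K \<in> ?B // scaling_rel ?B" for K
    using that equiv_scaling_rel equiv_class_eq[OF equiv_scaling_rel] by (metis quotientE)
  moreover have "scaling_rel ?B `` {N} \<in> ?B // scaling_rel ?B"
    using N by (rule quotientI)
  ultimately have "?B // scaling_rel ?B = {scaling_rel ?B `` {N}}" by blast
  then show ?thesis by (simp add: is_singleton_def)
qed

end

section \<open>Homogenization of polytopes\<close>

lemma homogenizationI: "0 \<le> t \<Longrightarrow> x \<in> P \<Longrightarrow> t *\<^sub>R (x, 1) \<in> homogenization P"
  by (auto simp: homogenization_def)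

lemma mem_homogenization_iff: "(x, 1) \<in> homogenization P \<longleftrightarrow> x \<in> P"
  by (auto simp: homogenization_def intro: exI[of _ 1])

lemma homogenization_nonzeroE:
  assumes "z \<in> homogenization P" "z \<noteq> 0"
  obtains t x where "0 < t" "x \<in> P" "z = t *\<^sub>R (x, 1)"
proof -
  obtain t x where tx: "0 \<le> t" "x \<in> P" "z = t *\<^sub>R (x, 1)"
    using assms(1) by (auto simp: homogenization_def)
  then have "t \<noteq> 0" using assms(2) by (metis scaleR_zero_left)
  then show thesis using that tx by (metis less_eq_real_def)
qed

lemma homogenization_point: "homogenization {x} = convex_cone hull {(x, 1)}"
  by (auto simp: homogenization_def convex_cone_hull_singleton)

lemma convex_cone_homogenization:
  assumes "convex P" "P \<noteq> {}"
  shows "convex_cone (homogenization P)"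
  unfolding convex_cone_iff
proof (intro conjI ballI allI impI)
  obtain x where "x \<in> P" using assms by blast
  then show "0 \<in> homogenization P" using homogenizationI[of 0 x P] by (simp add: zero_prod_def)
next
  fix y z assume "y \<in> homogenization P" "z \<in> homogenization P"
  then obtain s t x x' where yz: "0 \<le> s" "x \<in> P" "y = s *\<^sub>R (x, 1)" "0 \<le> t" "x' \<in> P"
    "z = t *\<^sub>R (x', 1)"
    unfolding homogenization_def by blast
  show "y + z \<in> homogenization P"
  proof (cases "s + t = 0")
    case True
    then have "s = 0" "t = 0" using yz by auto
    then show ?thesis using yz homogenizationI[of 0 x P] by (simp add: zero_prod_def)
  next
    case False
    then have pos: "0 < s + t" using yz by auto
    let ?x = "(s / (s + t)) *\<^sub>R x + (t / (s + t)) *\<^sub>R x'"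
    have "?x \<in> P"
      using assms(1) yz pos by (intro convexD) (auto simp: add_divide_distrib[symmetric])
    moreover have "y + z = (s + t) *\<^sub>R (?x, 1)"
      using pos yz by (simp add: scaleR_add_right)
    ultimately show ?thesis using homogenizationI pos by (metis less_imp_le)
  qed
next
  fix z and c :: real assume z: "z \<in> homogenization P" "0 \<le> c"
  then obtain t x where "0 \<le> t" "x \<in> P" "z = t *\<^sub>R (x, 1)"
    unfolding homogenization_def by blast
  then show "c *\<^sub>R z \<in> homogenization P"
    using z homogenizationI[of "c * t" x P] by simp
qed

text \<open>Generators of rays are determined only up to positive factors, so the lifted vertices
  carry arbitrary factors \<open>s j\<close>.\<close>

lemma homogenization_convex_hull:
  fixes v :: "'j::finite \<Rightarrow> 'v::euclidean_space"
  assumes s: "\<And>j. 0 < s j"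
  shows "homogenization (convex hull range v) = convex_cone hull range (\<lambda>j. s j *\<^sub>R (v j, 1))"
    (is "_ = ?C")
proof
  show "?C \<subseteq> homogenization (convex hull range v)"
    using s by (intro hull_minimal convex_cone_homogenization convex_convex_hull)
      (auto simp del: scaleR_Pair intro!: homogenizationI hull_inc simp: less_imp_le)
  have "(v j, 1) \<in> ?C" for j
  proof -
    have "(1 / s j) *\<^sub>R (s j *\<^sub>R (v j, 1 :: real)) \<in> ?C"
      using s[of j] by (intro convex_cone_hull_mul hull_inc) (auto simp: less_imp_le)
    then show ?thesis using s[of j] by simp
  qed
  moreover have "convex {x. (x, 1) \<in> ?C}"
  proof (rule convexI, clarify)
    fix x y and a b :: real
    assume xy: "(x, 1) \<in> ?C" "(y, 1) \<in> ?C" "0 \<le> a" "0 \<le> b" "a + b = 1"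
    have "a *\<^sub>R (x, 1) + b *\<^sub>R (y, 1) \<in> ?C"
      using convexD[OF convex_convex_cone_hull xy] .
    then show "(a *\<^sub>R x + b *\<^sub>R y, 1) \<in> ?C" using xy(5) by simp
  qed
  ultimately have "convex hull range v \<subseteq> {x. (x, 1) \<in> ?C}"
    by (intro hull_minimal) auto
  then have "t *\<^sub>R (x, 1) \<in> ?C" if "0 \<le> t" "x \<in> convex hull range v" for t x
    using that by (intro convex_cone_hull_mul) auto
  then show "homogenization (convex hull range v) \<subseteq> ?C"
    by (auto simp only: homogenization_def)
qed

text \<open>What a facet-ray matrix of a homogenization amounts to in coordinates: normals
  \<open>h i\<close> paired with positive multiples of the lifted vertices. Both directions of the
  comparison of realizations start from it.\<close>

definition homogenization_factorization ::
    "('i::finite \<times> 'j::finite) set \<Rightarrow> nat \<Rightarrow> 'v::euclidean_space set \<Rightarrow> ('i \<Rightarrow> 'v set) \<Rightarrow> ('j \<Rightarrow> 'v) \<Rightarrow>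
      real^'j^'i \<Rightarrow> ('i \<Rightarrow> 'v \<times> real) \<Rightarrow> ('j \<Rightarrow> real) \<Rightarrow> bool" where
  "homogenization_factorization R d P G v N h s \<longleftrightarrow>
     (\<forall>j. 0 < s j) \<and> (\<forall>i j. N $ i $ j = h i \<bullet> (s j *\<^sub>R (v j, 1))) \<and>
     (\<forall>i. G i = {x \<in> P. h i \<bullet> (x, 1) = 0}) \<and>
     irredundant_vectors R d h (\<lambda>j. s j *\<^sub>R (v j, 1)) \<and>
     homogenization P = convex_cone hull range (\<lambda>j. s j *\<^sub>R (v j, 1)) \<and>
     N \<in> filled0_matrices R (d + 1)"

lemma homogenization_factorizationD:
  assumes "homogenization_factorization R d P G v N h s"
  shows "\<And>j. 0 < s j" "\<And>i j. N $ i $ j = h i \<bullet> (s j *\<^sub>R (v j, 1))"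
    "\<And>i. G i = {x \<in> P. h i \<bullet> (x, 1) = 0}"
    "irredundant_vectors R d h (\<lambda>j. s j *\<^sub>R (v j, 1))"
    "homogenization P = convex_cone hull range (\<lambda>j. s j *\<^sub>R (v j, 1))"
    "N \<in> filled0_matrices R (d + 1)"
  using assms unfolding homogenization_factorization_def by (elim conjE; simp)+

context irredundant_relation
begin

text \<open>The slack \<open>a i \<bullet> v j - b i\<close> is the inner product of
  \<open>(a i, - b i)\<close> and \<open>(v j, 1)\<close>; that \<open>P\<close> is full-dimensional
  comes out of the dimension count for these lifts. Nonemptiness of \<open>G i\<close> matters
  because the homogenization of the empty set is empty, whereas the faces of the cone contain
  0.\<close>

lemma facet_ray_matrix_of_slacks:
  fixes v :: "'j \<Rightarrow> 'v::euclidean_space"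
  assumes dim: "DIM('v) = d"
    and P: "P = convex hull range v"
    and G: "\<And>i. G i = {x \<in> P. a i \<bullet> x = b i}" "\<And>i. G i \<noteq> {}"
    and N: "filled_incidence 0 R (\<chi> i j. a i \<bullet> v j - b i)"
  shows "(\<chi> i j. a i \<bullet> v j - b i) \<in> homogenization_matrices (P, G, v)"
proof -
  define h where "h i = (a i, - b i)" for i
  define w where "w j = (v j, 1 :: real)" for j
  have hw: "(\<chi> i j. a i \<bullet> v j - b i) = (\<chi> i j. h i \<bullet> w j)"
    by (simp add: vec_eq_iff h_def w_def)
  interpret irredundant_vectors R d h w
    by (rule irredundant_vectors[OF _ N]) (use dim in \<open>simp_all add: h_def w_def\<close>)
  have C: "homogenization P = C"
    using homogenization_convex_hull[of "\<lambda>_. 1" v] by (simp add: P w_def)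
  have "homogenization (G i) = {x \<in> C. h i \<bullet> x = 0}" for i
  proof
    show "homogenization (G i) \<subseteq> {x \<in> C. h i \<bullet> x = 0}"
      unfolding C[symmetric] by (auto simp: homogenization_def G(1) h_def algebra_simps)
    show "{x \<in> C. h i \<bullet> x = 0} \<subseteq> homogenization (G i)"
    proof clarify
      fix z assume z: "z \<in> C" "h i \<bullet> z = 0"
      show "z \<in> homogenization (G i)"
      proof (cases "z = 0")
        case True
        obtain x where "x \<in> G i" using G(2) by blast
        then have "0 *\<^sub>R (x, 1) \<in> homogenization (G i)" by (intro homogenizationI) simp_all
        then show ?thesis using True by (simp add: zero_prod_def)
      next
        case False
        then obtain t x where tx: "0 < t" "x \<in> P" "z = t *\<^sub>R (x, 1)"
          using z(1) homogenization_nonzeroE unfolding C[symmetric] by blast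
        then have "t * (a i \<bullet> x - b i) = 0" using z(2) by (simp add: h_def algebra_simps)
        then have "x \<in> G i" using tx by (simp add: G(1))
        then show ?thesis using tx homogenizationI by (metis less_imp_le)
      qed
    qed
  qed
  moreover have "homogenization {v j} = convex_cone hull {w j}" for j
    by (simp add: homogenization_point w_def)
  ultimately show ?thesis
    using facet_ray_matrix by (simp add: homogenization_matrices_def hw C)
qed

lemma type_polytope_convex_hull:
  "(P, G, v) \<in> type_polytopes R \<Longrightarrow> P = convex hull range v"
  unfolding type_polytopes_def bij_betw_def
  by (auto simp: polytope_imp_compact polytope_imp_convex intro!: Krein_Milman_Minkowski)

text \<open>Facets of a polytope are exposed, so each has a supporting inequality, whose slacks at
  the vertices have the required zero pattern.\<close>

lemma homogenization_matrices_nonempty: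
  fixes X :: "('i, 'j, 'v::euclidean_space) realization"
  assumes dim: "DIM('v) = d" and X: "X \<in> type_polytopes R"
  shows "homogenization_matrices X \<noteq> {}"
proof -
  obtain P G v where X_eq: "X = (P, G, v)" by (cases X)
  have P: "polytope P" and facets: "range G = {T. T facet_of P}"
    and inc: "\<And>i j. v j \<in> G i \<longleftrightarrow> (i, j) \<in> R"
    using X unfolding X_eq type_polytopes_def bij_betw_def by auto
  have "\<exists>a b. P \<subseteq> {x. a \<bullet> x \<le> b} \<and> G i = P \<inter> {x. a \<bullet> x = b}" for i
  proof -
    have G: "G i facet_of P" using facets by blast
    then have "G i face_of P" "G i \<noteq> {}" "G i \<noteq> P" by (auto simp: facet_of_def)
    then show ?thesis
      using exposed_face_of_polyhedron[OF polytope_imp_polyhedron[OF P]] exposed_face_of by metis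
  qed
  then obtain a b where ab: "\<And>i. P \<subseteq> {x. a i \<bullet> x \<le> b i}" "\<And>i. G i = P \<inter> {x. a i \<bullet> x = b i}"
    by metis
  have hull: "P = convex hull range v" using X unfolding X_eq by (rule type_polytope_convex_hull)
  have v: "v j \<in> P" for j unfolding hull by (simp add: hull_inc)
  have le: "a i \<bullet> v j \<le> b i" for i j using ab(1)[of i] v[of j] by blast
  have "(i, j) \<in> R \<longleftrightarrow> a i \<bullet> v j = b i" for i j
    using inc[of j i] ab(2)[of i] v[of j] by blast
  then have N: "filled_incidence 0 R (\<chi> i j. a i \<bullet> v j - b i)"
    using le by (auto simp: filled_incidence_def less_le)
  have "(\<chi> i j. a i \<bullet> v j - b i) \<in> homogenization_matrices (P, G, v)"
  proof (rule facet_ray_matrix_of_slacks[OF dim hull _ _ N])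
    show "G i = {x \<in> P. a i \<bullet> x = b i}" for i using ab(2) by blast
    show "G i \<noteq> {}" for i using facets by (auto simp: facet_of_def)
  qed
  then show ?thesis unfolding X_eq by blast
qed

text \<open>A generator of the ray over \<open>v j\<close> is nonzero, since this ray contains
  \<open>(v j, 1)\<close>, and so it is a positive multiple of the lift.\<close>

lemma ex_homogenization_factorization:
  fixes v :: "'j \<Rightarrow> 'v::euclidean_space"
  assumes dim: "DIM('v) = d"
    and X: "(P, G, v) \<in> type_polytopes R" and mat: "N \<in> homogenization_matrices (P, G, v)"
  shows "\<exists>h s. homogenization_factorization R d P G v N h s"
proof -
  have inc: "\<And>i j. v j \<in> G i \<longleftrightarrow> (i, j) \<in> R"
    using X unfolding type_polytopes_def by auto
  have hull: "P = convex hull range v" using X by (rule type_polytope_convex_hull)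
  have v: "v j \<in> P" for j unfolding hull by (simp add: hull_inc)
  have "facet_ray_matrix (homogenization P) (\<lambda>i. homogenization (G i))
      (\<lambda>j. homogenization {v j}) N"
    using mat by (simp add: homogenization_matrices_def)
  then obtain h w where "generators (range w) (homogenization P) \<and>
      (\<forall>j. homogenization {v j} = convex_cone hull {w j}) \<and>
      generators (range h) (polar_cone (homogenization P)) \<and>
      (\<forall>i. homogenization (G i) = {x \<in> homogenization P. h i \<bullet> x = 0}) \<and>
      (\<forall>i j. N $ i $ j = h i \<bullet> w j)"
    unfolding facet_ray_matrix_def by (elim conjE exE) (rule that, intro conjI)
  then have hw: "convex_cone hull range w = homogenization P"
    "\<And>j. homogenization {v j} = convex_cone hull {w j}"
    "convex_cone hull range h = polar_cone (homogenization P)"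
    "\<And>i. homogenization (G i) = {x \<in> homogenization P. h i \<bullet> x = 0}"
    "\<And>i j. N $ i $ j = h i \<bullet> w j"
    unfolding generators_def by simp_all
  have "\<exists>s>0. w j = s *\<^sub>R (v j, 1)" for j
  proof -
    have "w j \<noteq> 0"
    proof
      assume "w j = 0"
      then have "homogenization {v j} = {0}" by (auto simp: hw(2) convex_cone_hull_singleton)
      moreover have "(v j, 1) \<in> homogenization {v j}" by (simp add: mem_homogenization_iff)
      ultimately show False by (simp add: zero_prod_def)
    qed
    moreover have "w j \<in> homogenization {v j}" by (simp add: hw(2) hull_inc)
    ultimately show ?thesis using homogenization_nonzeroE by (metis singletonD)
  qed
  then obtain s where s: "\<And>j. 0 < s j" "\<And>j. w j = s j *\<^sub>R (v j, 1)" by metis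
  have G: "G i = {x \<in> P. h i \<bullet> (x, 1) = 0}" for i
  proof -
    have "x \<in> G i \<longleftrightarrow> x \<in> P \<and> h i \<bullet> (x, 1) = 0" for x
      using hw(4)[of i] mem_homogenization_iff[of x "G i"] mem_homogenization_iff[of x P] by auto
    then show ?thesis by blast
  qed
  have "w j \<in> homogenization P" for j using hw(1) by (metis hull_inc rangeI)
  moreover have "h i \<in> polar_cone (homogenization P)" for i using hw(3) by (metis hull_inc rangeI)
  ultimately have le: "N $ i $ j \<le> 0" for i j
    using hw(5) by (simp add: polar_cone_def)
  have "N $ i $ j = 0 \<longleftrightarrow> (i, j) \<in> R" for i j
  proof -
    have "N $ i $ j = 0 \<longleftrightarrow> h i \<bullet> (v j, 1) = 0"
      using s(1)[of j] by (simp only: hw(5) s(2) inner_scaleR_right) simp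
    then show ?thesis using G[of i] v[of j] inc[of j i] by blast
  qed
  then have filled: "filled_incidence 0 R N"
    using le unfolding filled_incidence_def by (auto simp: less_le)
  have "N = (\<chi> i j. h i \<bullet> w j)" by (simp add: vec_eq_iff hw(5))
  then have "rank N \<le> d + 1" using rank_inner_matrix_le[of h w] dim by simp
  then have "N \<in> filled0_matrices R (d + 1)" using filled by (rule filled0_matrices_if_rank_le[rotated])
  moreover have "irredundant_vectors R d h w"
    by (rule irredundant_vectors[OF _ filled hw(5)]) (use dim in simp)
  moreover have "w = (\<lambda>j. s j *\<^sub>R (v j, 1))" using s(2) by blast
  ultimately have "homogenization_factorization R d P G v N h s"
    unfolding homogenization_factorization_def
    using s(1) hw(1,5)[symmetric] G by (intro conjI allI) simp_all
  then show ?thesis by blast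
qed

section \<open>Projective equivalence against scaling equivalence\<close>

text \<open>In homogeneous coordinates \<open>T\<close> multiplies the lifted vertices by factors
  \<open>\<tau> j\<close>, which go into the columns. The normals \<open>h' i\<close> pulled back
  along \<open>T\<close> have the zero pattern of the \<open>h i\<close>; as the lifts on a facet
  span a hyperplane, they are multiples of the \<open>h i\<close>, and these multiples go into the
  rows.\<close>

lemma projective_rel_imp_scaling_rel:
  fixes X X' :: "('i, 'j, 'v::euclidean_space) realization"
  assumes dim: "DIM('v) = d" and rel: "(X, X') \<in> projective_rel R"
    and mats: "N \<in> homogenization_matrices X" "N' \<in> homogenization_matrices X'"
  shows "(N, N') \<in> scaling_rel (filled0_matrices R (d + 1))"
proof -
  obtain P G v P' G' v' where X_eq: "X = (P, G, v)" "X' = (P', G', v')"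
    by (cases X; cases X')
  have X: "(P, G, v) \<in> type_polytopes R" "(P', G', v') \<in> type_polytopes R"
    using rel unfolding X_eq projective_rel_def by auto
  obtain T where T: "linear T" "\<And>x. x \<in> P \<Longrightarrow> snd (T (x, 1)) \<noteq> 0"
    "\<And>j. v' j = projective_map T (v j)"
    using rel unfolding X_eq projective_rel_def by auto
  have mats': "N \<in> homogenization_matrices (P, G, v)" "N' \<in> homogenization_matrices (P', G', v')"
    using mats unfolding X_eq by auto
  obtain h s where "homogenization_factorization R d P G v N h s"
    using ex_homogenization_factorization[OF dim X(1) mats'(1)] by blast
  note hs = homogenization_factorizationD[OF this]
  obtain h' s' where "homogenization_factorization R d P' G' v' N' h' s'"
    using ex_homogenization_factorization[OF dim X(2) mats'(2)] by blast
  note hs' = homogenization_factorizationD[OF this]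
  define \<tau> where "\<tau> j = snd (T (v j, 1))" for j
  have hull: "P = convex hull range v" using X(1) by (rule type_polytope_convex_hull)
  have v: "v j \<in> P" for j unfolding hull by (simp add: hull_inc)
  have \<tau>0: "\<tau> j \<noteq> 0" for j unfolding \<tau>_def using T(2) v by blast
  have \<tau>: "0 < \<tau> j * \<tau> k" for j k
  proof (rule ccontr)
    assume "\<not> 0 < \<tau> j * \<tau> k"
    then have neg: "\<tau> j * \<tau> k < 0" using \<tau>0[of j] \<tau>0[of k] by (metis linorder_cases mult_eq_0_iff)
    then have ne: "\<tau> j - \<tau> k \<noteq> 0" by (metis eq_iff_diff_eq_0 not_square_less_zero)
    \<comment> \<open>The weights at which the last coordinate of \<open>T\<close>, affine along the
      segment from \<open>v j\<close> to \<open>v k\<close>, vanishes if it changes sign.\<close>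
    let ?u = "- \<tau> k / (\<tau> j - \<tau> k)" and ?t = "\<tau> j / (\<tau> j - \<tau> k)"
    have sum: "?u + ?t = 1" unfolding add_divide_distrib[symmetric] using ne by simp
    have "0 \<le> ?u" "0 \<le> ?t"
      using neg by (auto simp: mult_less_0_iff zero_le_divide_iff divide_le_0_iff)
    then have "?u *\<^sub>R v j + ?t *\<^sub>R v k \<in> P"
      unfolding hull using sum by (intro convexD[OF convex_convex_hull]) (auto intro: hull_inc)
    then have "snd (T (?u *\<^sub>R v j + ?t *\<^sub>R v k, 1)) \<noteq> 0" by (rule T(2))
    moreover have "(?u *\<^sub>R v j + ?t *\<^sub>R v k, 1 :: real) = ?u *\<^sub>R (v j, 1) + ?t *\<^sub>R (v k, 1)"
      using sum by simp
    then have "snd (T (?u *\<^sub>R v j + ?t *\<^sub>R v k, 1)) = ?u * \<tau> j + ?t * \<tau> k"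
      unfolding \<tau>_def by (simp only: linear_add[OF T(1)] linear_scale[OF T(1)] snd_add snd_scaleR real_scaleR_def)
    moreover have "?u * \<tau> j + ?t * \<tau> k = 0" by (simp add: field_simps)
    ultimately show False by simp
  qed
  interpret V: irredundant_vectors R d h "\<lambda>j. s j *\<^sub>R (v j, 1)" by (rule hs(4))
  \<comment> \<open>All \<open>\<tau> j\<close> share one sign, and the vertex of arbitrary index
    \<open>undefined\<close> supplies it. Putting \<open>\<epsilon>\<close> into both
    \<open>t\<close> and \<open>k\<close> keeps the factors positive even if \<open>T\<close>
    reverses the cone.\<close>
  define \<epsilon> where "\<epsilon> = \<tau> undefined"
  define t where "t j = s' j / (s j * \<epsilon> * \<tau> j)" for j
  have t: "0 < t j" for j
    unfolding t_def using hs(1)[of j] hs'(1)[of j] \<tau>[of undefined j] unfolding \<epsilon>_def[symmetric]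
    by (simp add: mult.assoc)
  have Tv: "T (v j, 1) = \<tau> j *\<^sub>R (v' j, 1)" for j
    using \<tau>0[of j] by (simp add: T(3) projective_map_def \<tau>_def prod_eq_iff)
  define k where "k i = \<epsilon> *\<^sub>R adjoint T (h' i)" for i
  have k: "N' $ i $ j = t j * (k i \<bullet> (s j *\<^sub>R (v j, 1)))" for i j
  proof -
    have "k i \<bullet> (s j *\<^sub>R (v j, 1)) = \<epsilon> * s j * (h' i \<bullet> T (v j, 1))"
      using adjoint_works[OF T(1), of "(v j, 1)" "h' i"]
      by (simp only: k_def inner_scaleR_left inner_scaleR_right inner_commute[of _ "(v j, 1)"]
          inner_commute[of _ "T (v j, 1)"]) (simp add: inner_commute)
    also have "\<dots> = \<epsilon> * s j * \<tau> j * (h' i \<bullet> (v' j, 1))" by (simp only: Tv inner_scaleR_right mult.assoc)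
    finally show ?thesis
      using hs(1)[of j] \<tau>0[of j] \<tau>0[of undefined] hs'(2)[of i j]
      by (simp only: t_def inner_scaleR_right) (simp add: \<epsilon>_def)
  qed
  have filled': "filled_incidence 0 R N'" using hs'(6) by (simp add: filled0_matrices_def)
  have k_zero: "k i \<bullet> (s j *\<^sub>R (v j, 1)) = 0" if "(i, j) \<in> R" for i j
  proof -
    have "N' $ i $ j = 0" using filled' that unfolding filled_incidence_def by metis
    then show ?thesis using k t[of j] by (metis less_irrefl mult_eq_0_iff)
  qed
  have k_neg: "k i \<bullet> (s j *\<^sub>R (v j, 1)) < 0" if "(i, j) \<notin> R" for i j
  proof -
    have "N' $ i $ j < 0" using filled' that unfolding filled_incidence_def by metis
    then show ?thesis using k[of i j] t[of j] by (metis mult_less_0_iff not_less_iff_gr_or_eq)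
  qed
  have "\<exists>c>0. \<forall>x. k i \<bullet> x = c * (h i \<bullet> x)" for i
  proof -
    let ?w = "\<lambda>j. s j *\<^sub>R (v j, 1 :: real)"
    obtain j where j: "(i, j) \<notin> R" using row_complement by blast
    obtain c where "c > 0" "\<And>x. x \<in> span (range ?w) \<Longrightarrow> k i \<bullet> x = c * (h i \<bullet> x)"
    proof (rule proportional_functionals)
      show "?w ` {j. (i, j) \<in> R} \<subseteq> range ?w" by (rule image_mono) simp
      show "dim (range ?w) = dim (?w ` {j. (i, j) \<in> R}) + 1"
        using V.dim_facet V.dim_range by simp
      show "h i \<bullet> b = 0" "k i \<bullet> b = 0" if b: "b \<in> ?w ` {j. (i, j) \<in> R}" for b
      proof -
        obtain j where j: "(i, j) \<in> R" "b = ?w j" using b by blast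
        show "h i \<bullet> b = 0" "k i \<bullet> b = 0"
          unfolding j(2) by (rule V.inner_eq[OF j(1)] k_zero[OF j(1)])+
      qed
      show "h i \<bullet> b \<le> 0" "k i \<bullet> b \<le> 0" if b: "b \<in> range ?w" for b
      proof -
        obtain j where j: "b = ?w j" using b by blast
        show "h i \<bullet> b \<le> 0" unfolding j by (rule V.inner_le)
        show "k i \<bullet> b \<le> 0"
          unfolding j using k_zero[of i j] k_neg[of i j] by (metis less_imp_le order_refl)
      qed
      show "\<exists>a\<in>range ?w. h i \<bullet> a < 0" "\<exists>a\<in>range ?w. k i \<bullet> a < 0"
        using V.inner_less[OF j] k_neg[OF j] by blast+
    qed blast
    then show ?thesis using V.span_range by (metis UNIV_I)
  qed
  then obtain c where c: "\<And>i. 0 < c i" "\<And>i x. k i \<bullet> x = c i * (h i \<bullet> x)" by metis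
  have "N' = rescale c t N"
    by (simp only: vec_eq_iff k c(2) hs(2) rescale_nth) (simp add: mult.commute mult.left_commute)
  then show ?thesis
    using scaling_rel_iff hs(6) hs'(6) c(1) t by blast
qed

text \<open>The transformation is found on the slack coordinates: \<open>h\<close> and \<open>h'\<close> embed the two
  homogenized spaces in \<open>real^'i\<close>, where it is a positive diagonal matrix.\<close>

lemma scaling_rel_imp_projective_rel:
  fixes X X' :: "('i, 'j, 'v::euclidean_space) realization"
  assumes dim: "DIM('v) = d" and X: "X \<in> type_polytopes R" "X' \<in> type_polytopes R"
    and mats: "N \<in> homogenization_matrices X" "N' \<in> homogenization_matrices X'"
    and rel: "(N, N') \<in> scaling_rel S"
  shows "(X, X') \<in> projective_rel R"
proof -
  obtain P G v P' G' v' where X_eq: "X = (P, G, v)" "X' = (P', G', v')"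
    by (cases X; cases X')
  have mats': "N \<in> homogenization_matrices (P, G, v)" "N' \<in> homogenization_matrices (P', G', v')"
    using mats unfolding X_eq by auto
  have X': "(P, G, v) \<in> type_polytopes R" "(P', G', v') \<in> type_polytopes R"
    using X unfolding X_eq by auto
  obtain h s where "homogenization_factorization R d P G v N h s"
    using ex_homogenization_factorization[OF dim X'(1) mats'(1)] by blast
  note hs = homogenization_factorizationD[OF this]
  obtain h' s' where "homogenization_factorization R d P' G' v' N' h' s'"
    using ex_homogenization_factorization[OF dim X'(2) mats'(2)] by blast
  note hs' = homogenization_factorizationD[OF this]
  obtain m l where ml: "\<And>i. 0 < m i" "\<And>j. 0 < l j" "N' = rescale m l N"
    using rel by (auto simp: scaling_rel_iff)
  define w where "w j = s j *\<^sub>R (v j, 1 :: real)" for j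
  \<comment> \<open>Dividing by \<open>l j\<close> absorbs the column scaling, so the slacks of
    \<open>w j\<close> and \<open>w' j\<close> differ only by the row factors
    \<open>m i\<close>.\<close>
  define w' where "w' j = (s' j / l j) *\<^sub>R (v' j, 1 :: real)" for j
  interpret V: irredundant_vectors R d h w using hs(4) unfolding w_def .
  interpret V': irredundant_vectors R d h' "\<lambda>j. s' j *\<^sub>R (v' j, 1)" by (rule hs'(4))
  let ?H = "\<lambda>x. \<chi> i. h' i \<bullet> x"
  have H: "linear ?H" by (rule linearI) (simp_all add: vec_eq_iff inner_add_right)
  have "inj ?H"
    using V'.eq_zero_if_orthogonal by (subst linear_inj_iff_eq_0[OF H]) (auto simp: vec_eq_iff)
  then obtain g where g: "linear g" "\<And>x. g (?H x) = x"
    using linear_injective_left_inverse[OF H] by (metis comp_apply id_apply)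
  let ?D = "\<lambda>x. \<chi> i. m i * (h i \<bullet> x)"
  have D: "linear ?D"
    by (rule linearI) (simp_all add: vec_eq_iff inner_add_right distrib_left mult.left_commute)
  \<comment> \<open>The map \<open>g\<close> inverts the slack map only on its image;
    \<open>?D\<close> sends the generators, and so by linearity every point, into that
    image.\<close>
  define T where "T = g \<circ> ?D"
  have T: "linear T" unfolding T_def by (rule linear_compose[OF D g(1)])
  have hw': "h' i \<bullet> w' j = m i * (h i \<bullet> w j)" for i j
  proof -
    have "l j * (h' i \<bullet> w' j) = N' $ i $ j"
      by (simp only: w'_def hs'(2) inner_scaleR_right) (use ml(2)[of j] in simp)
    also have "\<dots> = l j * (m i * (h i \<bullet> w j))"
      using hs(2)[of i j] by (simp add: ml(3) w_def)
    finally show ?thesis using ml(2)[of j] by simp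
  qed
  have Tw: "T (w j) = w' j" for j
  proof -
    have "?D (w j) = ?H (w' j)" by (simp add: vec_eq_iff hw')
    then show ?thesis using g(2)[of "w' j"] by (simp add: T_def)
  qed
  have hT: "h' i \<bullet> T x = m i * (h i \<bullet> x)" for i x
  proof -
    have "subspace {x. h' i \<bullet> T x = m i * (h i \<bullet> x)}"
      by (rule subspaceI) (simp_all add: linear_0[OF T] linear_add[OF T] linear_scale[OF T]
          inner_add_right distrib_left mult.left_commute)
    then have "span (range w) \<subseteq> {x. h' i \<bullet> T x = m i * (h i \<bullet> x)}"
      by (intro span_minimal) (auto simp: Tw hw')
    then show ?thesis using V.span_range by auto
  qed
  have "inj T"
  proof (subst linear_inj_iff_eq_0[OF T], intro allI impI)
    fix x assume "T x = 0"
    then have "m i * (h i \<bullet> x) = 0" for i using hT[of i x] by simp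
    then have "h i \<bullet> x = 0" for i using ml(1)[of i] by (metis less_irrefl mult_eq_0_iff)
    then show "x = 0" by (rule V.eq_zero_if_orthogonal)
  qed
  then have "bij T" using linear_inj_imp_surj[OF T] by (simp add: bij_def)
  have hull': "P' = convex hull range v'"
    using X(2) unfolding X_eq by (rule type_polytope_convex_hull)
  have "homogenization P' = convex_cone hull range w'"
    unfolding hull' w'_def using hs'(1) ml(2) by (intro homogenization_convex_hull) auto
  also have "\<dots> = T ` homogenization P"
    unfolding hs(5) w_def[symmetric] convex_cone_hull_linear_image[OF T, symmetric]
    by (simp add: image_image Tw)
  finally have cone: "homogenization P' = T ` homogenization P" .
  \<comment> \<open>\<open>T\<close> carries one homogenization onto the other, and nonzero points
    of a homogenization have positive last coordinate; so no point of \<open>P\<close> is sent to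
    infinity.\<close>
  have point: "snd (T (x, 1)) \<noteq> 0 \<and> projective_map T x \<in> P' \<and>
      T (x, 1) = snd (T (x, 1)) *\<^sub>R (projective_map T x, 1)" if "x \<in> P" for x
  proof -
    have "T (x, 1) \<in> homogenization P'"
      unfolding cone using that by (simp add: mem_homogenization_iff)
    moreover have "T (x, 1) \<noteq> 0"
      using \<open>inj T\<close> linear_inj_iff_eq_0[OF T] by (metis Pair_inject zero_neq_one zero_prod_def)
    ultimately obtain t y where "0 < t" "y \<in> P'" "T (x, 1) = t *\<^sub>R (y, 1)"
      by (rule homogenization_nonzeroE)
    then show ?thesis by (simp add: projective_map_def)
  qed
  have onto: "\<exists>x\<in>P. y = projective_map T x" if "y \<in> P'" for y
  proof -
    have "(y, 1) \<in> T ` homogenization P"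
      unfolding cone[symmetric] using that by (simp add: mem_homogenization_iff)
    then obtain z where z: "z \<in> homogenization P" "T z = (y, 1)" by auto
    then have "z \<noteq> 0" using linear_0[OF T] by (auto simp: zero_prod_def)
    then obtain t x where tx: "0 < t" "x \<in> P" "z = t *\<^sub>R (x, 1)"
      using z homogenization_nonzeroE by blast
    then have "t *\<^sub>R T (x, 1) = (y, 1)" using z(2) linear_scale[OF T] by metis
    then have "(1 / t) *\<^sub>R (t *\<^sub>R T (x, 1)) = (1 / t) *\<^sub>R (y, 1)" by (rule arg_cong)
    then have "T (x, 1) = (1 / t) *\<^sub>R (y, 1)"
      using tx(1) by (simp only: scaleR_scaleR) simp
    then have "projective_map T x = y" using tx(1) by (simp add: projective_map_def)
    then show ?thesis using tx by blast
  qed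
  have P': "P' = projective_map T ` P" using point onto by blast
  have mem: "projective_map T x \<in> G' i \<longleftrightarrow> x \<in> G i" if "x \<in> P" for x i
  proof -
    have "snd (T (x, 1)) * (h' i \<bullet> (projective_map T x, 1)) = m i * (h i \<bullet> (x, 1))"
      using point[OF that] hT[of i "(x, 1)"] by (metis inner_scaleR_right)
    then have "h' i \<bullet> (projective_map T x, 1) = 0 \<longleftrightarrow> h i \<bullet> (x, 1) = 0"
      using point[OF that] ml(1)[of i] by (metis less_irrefl mult_eq_0_iff)
    then show ?thesis using point[OF that] that unfolding hs(3) hs'(3) by blast
  qed
  have "G' i = projective_map T ` G i" for i
  proof -
    have "G' i \<subseteq> P'" "G i \<subseteq> P" using hs(3) hs'(3) by auto
    then have "y \<in> projective_map T ` G i" if "y \<in> G' i" for y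
      using that mem[of _ i] onto[of y] by blast
    moreover have "projective_map T x \<in> G' i" if "x \<in> G i" for x
      using that mem[of x i] \<open>G i \<subseteq> P\<close> by blast
    ultimately show ?thesis by blast
  qed
  moreover have "v' j = projective_map T (v j)" for j
  proof -
    have "s j *\<^sub>R T (v j, 1) = (s' j / l j) *\<^sub>R (v' j, 1)"
      using Tw[of j] linear_scale[OF T] unfolding w_def w'_def by metis
    then have "fst (s j *\<^sub>R T (v j, 1)) = (s' j / l j) *\<^sub>R v' j"
      "snd (s j *\<^sub>R T (v j, 1)) = s' j / l j" by simp_all
    then have "s j *\<^sub>R fst (T (v j, 1)) = (s j * snd (T (v j, 1))) *\<^sub>R v' j"
      by (simp only: fst_scaleR snd_scaleR real_scaleR_def)
    then have "s j *\<^sub>R fst (T (v j, 1)) = s j *\<^sub>R (snd (T (v j, 1)) *\<^sub>R v' j)" by simp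
    then have "fst (T (v j, 1)) = snd (T (v j, 1)) *\<^sub>R v' j"
      using hs(1)[of j] by (metis less_irrefl scaleR_cancel_left)
    moreover have "v j \<in> P"
      using type_polytope_convex_hull X(1) unfolding X_eq by (metis hull_inc rangeI)
    ultimately show ?thesis using point[of "v j"] by (simp add: projective_map_def)
  qed
  ultimately show ?thesis
    using X T \<open>bij T\<close> point P' unfolding X_eq projective_rel_def by blast
qed

end

section \<open>Realizing a matrix by a polytope\<close>

lemma (in irredundant_relation) ex_realization:
  fixes N :: "real^'j^'i"
  assumes dim: "DIM('v::euclidean_space) = d" and N: "N \<in> filled0_matrices R (d + 1)"
  shows "\<exists>X :: ('i, 'j, 'v) realization. X \<in> type_polytopes R \<and>
    (\<exists>N'\<in>homogenization_matrices X. (N, N') \<in> scaling_rel (filled0_matrices R (d + 1)))"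
proof -
  have filled: "filled_incidence 0 R N" and rank: "rank N = d + 1"
    using N by (auto simp: filled0_matrices_def)
  obtain s t where st: "\<And>i. 0 < s i" "\<And>j. 0 < t j"
    "rank (\<chi> i j. rescale s t N $ i $ j + 1) + 1 = rank N"
    using rescaled_filled1_rank[OF filled nondegenerate] by blast
  then have "rank (\<chi> i j. rescale s t N $ i $ j + 1) \<le> DIM('v)"
    using rank dim by simp
  then obtain a :: "'i \<Rightarrow> 'v" and v
    where "\<And>i j. (\<chi> i j. rescale s t N $ i $ j + 1) $ i $ j = a i \<bullet> v j"
    using rank_factorization by blast
  then have av: "rescale s t N $ i $ j = a i \<bullet> v j - 1" for i j
    by (simp del: rescale_nth add: eq_diff_eq)
  then have slack: "rescale s t N = (\<chi> i j. a i \<bullet> v j - 1)"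
    by (simp del: rescale_nth add: vec_eq_iff)
  have filled': "filled_incidence 0 R (rescale s t N)"
    using filled_incidence_rescale[OF st(1,2) filled] .
  define h where "h i = (a i, -1 :: real)" for i
  define w where "w j = (v j, 1 :: real)" for j
  interpret irredundant_vectors R d h w
    by (rule irredundant_vectors[OF _ filled'])
      (use dim in \<open>simp_all del: rescale_nth add: av h_def w_def\<close>)
  define P where "P = convex hull range v"
  define G where "G i = {x \<in> P. a i \<bullet> x = 1}" for i
  have hom: "homogenization P = C"
    using homogenization_convex_hull[of "\<lambda>_. 1" v] by (simp add: P_def w_def)
  have PC: "x \<in> P \<longleftrightarrow> (x, 1) \<in> C" for x
    using mem_homogenization_iff[of x P] by (simp only: hom)
  then have P_iff: "x \<in> P \<longleftrightarrow> (\<forall>i. a i \<bullet> x \<le> 1)" for x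
    unfolding cone_eq by (simp add: h_def)
  then have P_eq: "P = {x. \<forall>i. a i \<bullet> x \<le> 1}" by blast
  have vG: "v j \<in> G i \<longleftrightarrow> (i, j) \<in> R" for i j
    using inner_zero_iff[of i j] by (auto simp: G_def P_def h_def w_def intro: hull_inc)
  \<comment> \<open>A facet without vertices would span dimension 0, but d is positive as the
    dimension of a Euclidean space.\<close>
  have row_ne: "{j. (i, j) \<in> R} \<noteq> {}" for i
  proof
    assume "{j. (i, j) \<in> R} = {}"
    then have "dim (w ` {}) = d" using dim_facet[of i] by simp
    then show False using dim DIM_positive[where 'a = 'v] by simp
  qed
  have a_nonzero: "a i \<noteq> 0" for i
  proof
    assume "a i = 0"
    moreover obtain j where "(i, j) \<in> R" using row_ne by blast
    then have "v j \<in> G i" using vG by blast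
    ultimately show False by (simp add: G_def)
  qed
  have dehomogenize: "h i \<bullet> z = snd z * (a i \<bullet> (fst z /\<^sub>R snd z) - 1)" if "0 < snd z" for i z
    using that by (cases z) (simp add: h_def algebra_simps)
  have "interior P \<noteq> {}"
  proof -
    have "0 < snd center" by (simp add: center_def w_def snd_sum)
    then have "a i \<bullet> (fst center /\<^sub>R snd center) < 1" for i
      using center_neg[of i] unfolding dehomogenize[OF \<open>0 < snd center\<close>]
      by (simp add: mult_less_0_iff)
    moreover have "open (\<Inter>i. {x. a i \<bullet> x < 1})"
      by (intro open_INT) (auto simp: open_halfspace_lt)
    moreover have "(\<Inter>i. {x. a i \<bullet> x < 1}) \<subseteq> P"
      unfolding P_eq by (auto simp: less_imp_le)
    ultimately show ?thesis using interior_maximal by blast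
  qed
  moreover have "\<exists>x. 1 < a i \<bullet> x \<and> (\<forall>k. k \<noteq> i \<longrightarrow> a k \<bullet> x \<le> 1)" for i
  proof -
    define n where "n = real (card {j. (i, j) \<in> R})"
    have "0 < n" unfolding n_def using row_ne by (simp add: card_gt_0_iff)
    have "0 < real CARD('j)" by simp
    \<comment> \<open>\<open>exposing_facet i\<close> has last coordinate \<open>n\<close> and
      \<open>center\<close> has \<open>CARD('j)\<close>; with this bound on \<open>e\<close> the
      difference keeps at least \<open>n / 2\<close> and can be dehomogenized.\<close>
    have "0 < n / (2 * real CARD('j))" using \<open>0 < n\<close> by simp
    then obtain e where e: "0 < e" "e \<le> n / (2 * real CARD('j))"
      "0 < h i \<bullet> (exposing_facet i - e *\<^sub>R center)"
      "\<And>k. k \<noteq> i \<Longrightarrow> h k \<bullet> (exposing_facet i - e *\<^sub>R center) \<le> 0"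
      using beyond_one_facet by blast
    let ?z = "exposing_facet i - e *\<^sub>R center"
    have "snd ?z = n - e * real CARD('j)"
      by (simp add: exposing_facet_def center_def w_def snd_sum n_def)
    moreover have "e * real CARD('j) \<le> n / 2"
      using mult_right_mono[OF e(2), of "real CARD('j)"] \<open>0 < real CARD('j)\<close> by simp
    ultimately have pos: "0 < snd ?z" using \<open>0 < n\<close> by simp
    show ?thesis
      using e(3,4) pos unfolding dehomogenize[OF pos]
      by (intro exI[of _ "fst ?z /\<^sub>R snd ?z"]) (simp add: zero_less_mult_iff mult_le_0_iff)
  qed
  ultimately have facet: "T facet_of P \<longleftrightarrow> (\<exists>i. T = P \<inter> {x. a i \<bullet> x = 1})" for T
    using a_nonzero by (intro facet_of_irredundant_polyhedron[where b = "\<lambda>_. 1"] P_eq) auto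
  have G_eq: "G i = P \<inter> {x. a i \<bullet> x = 1}" for i by (auto simp: G_def)
  have "range G = {T. T facet_of P}" using facet by (auto simp: G_eq)
  moreover have "inj G"
  proof
    fix i k assume "G i = G k"
    then have "(i, j) \<in> R \<longleftrightarrow> (k, j) \<in> R" for j by (simp flip: vG)
    then show "i = k" using separating_column by metis
  qed
  ultimately have bij_G: "bij_betw G UNIV {T. T facet_of P}" by (simp add: bij_betw_def)
  have extreme: "v j extreme_point_of P" for j
  proof -
    \<comment> \<open>The normal exposing ray j splits into a direction and an offset; its
      hyperplane meets the affine slice \<open>P\<close> of the cone only in
      \<open>v j\<close>.\<close>
    let ?e = "exposing_ray j"
    have "?e \<bullet> (x, 1) \<le> 0" if "x \<in> P" for x
      using that unfolding PC cone_eq exposing_ray_def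
      by (auto simp: inner_sum_left intro!: sum_nonpos)
    then have "fst ?e \<bullet> x + snd ?e \<le> 0" if "x \<in> P" for x
      using that by (simp add: inner_prod_def)
    then have "fst ?e \<bullet> x \<le> - snd ?e" if "x \<in> P" for x
      using that by (metis add_le_cancel_right add.left_inverse)
    then have "P \<inter> {x. fst ?e \<bullet> x = - snd ?e} face_of P"
      unfolding P_def by (intro face_of_Int_supporting_hyperplane_le convex_convex_hull)
    moreover have "P \<inter> {x. fst ?e \<bullet> x = - snd ?e} = {v j}"
    proof -
      have ray: "convex_cone hull {w j} = C \<inter> {x. ?e \<bullet> x = 0}"
        using exposing_ray_zero exposing_ray_neg by (rule convex_cone_hull_exposed)
      have "x \<in> P \<inter> {x. fst ?e \<bullet> x = - snd ?e} \<longleftrightarrow> (x, 1) \<in> convex_cone hull {w j}" for x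
        unfolding ray by (auto simp: PC inner_prod_def)
      then show ?thesis by (auto simp: convex_cone_hull_singleton w_def)
    qed
    ultimately show ?thesis by (simp add: face_of_singleton)
  qed
  have "range v = {x. x extreme_point_of P}"
    using extreme extreme_point_of_convex_hull unfolding P_def by blast
  moreover have "inj v"
  proof
    fix j k assume "v j = v k"
    then have "(i, j) \<in> R \<longleftrightarrow> (i, k) \<in> R" for i by (simp flip: vG)
    then show "j = k" using separating_row by metis
  qed
  ultimately have bij_v: "bij_betw v UNIV {x. x extreme_point_of P}" by (simp add: bij_betw_def)
  have "polytope P" unfolding P_def polytope_def by (intro exI[of _ "range v"]) simp
  then have X: "(P, G, v) \<in> type_polytopes R"
    using bij_G bij_v vG by (simp add: type_polytopes_def)
  have "G i \<noteq> {}" for i using row_ne vG by blast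
  then have mat: "rescale s t N \<in> homogenization_matrices (P, G, v)"
    unfolding slack
    by (intro facet_ray_matrix_of_slacks[OF dim P_def, where b = "\<lambda>_. 1"])
      (use filled' in \<open>simp_all add: G_def slack\<close>)
  have "rank (rescale s t N) = rank N" using st(1,2) by (rule rank_rescale)
  then have "rescale s t N \<in> filled0_matrices R (d + 1)"
    using filled' rank by (simp add: filled0_matrices_def)
  then have "(N, rescale s t N) \<in> scaling_rel (filled0_matrices R (d + 1))"
    unfolding scaling_rel_iff using N st(1,2) by blast
  then show ?thesis using X mat by blast
qed

section \<open>Bijections of quotients from an invariant\<close>

text \<open>The invariant \<open>m\<close> is multivalued and determined up to \<open>S\<close>.
  Symmetry and transitivity of \<open>r\<close> are pulled back from \<open>S\<close> along it, so
  for realizations they come from those of scaling.\<close>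

lemma quotient_bij_of_invariant:
  fixes m :: "'a \<Rightarrow> 'b set"
  assumes r: "r \<subseteq> A \<times> A" and S: "equiv B S"
    and m: "\<And>X. X \<in> A \<Longrightarrow> m X \<noteq> {}"
    and iff: "\<And>X Y M N. X \<in> A \<Longrightarrow> Y \<in> A \<Longrightarrow> M \<in> m X \<Longrightarrow> N \<in> m Y \<Longrightarrow>
      (X, Y) \<in> r \<longleftrightarrow> (M, N) \<in> S"
    and diagonal: "\<And>X. X \<in> A \<Longrightarrow> (X, X) \<in> r"
    and onto: "\<And>M. M \<in> B \<Longrightarrow> \<exists>X\<in>A. \<exists>N\<in>m X. (M, N) \<in> S"
  shows "equiv A r \<and> (\<exists>\<Phi>. bij_betw \<Phi> (A // r) (B // S) \<and>
    (\<forall>X. X \<in> A \<longrightarrow> m X \<noteq> {} \<and> (\<forall>N\<in>m X. \<Phi> (r `` {X}) = S `` {N})))"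
proof -
  have S': "sym S" "trans S" using S by (auto simp: equiv_def)
  have r': "equiv A r"
  proof (rule equivI[OF r])
    show "refl_on A r" using diagonal by (rule refl_onI)
    show "sym r"
    proof (rule symI)
      fix X Y assume XY: "(X, Y) \<in> r"
      then have "X \<in> A" "Y \<in> A" using r by auto
      then obtain M N where "M \<in> m X" "N \<in> m Y" using m by blast
      then show "(Y, X) \<in> r"
        using iff XY \<open>X \<in> A\<close> \<open>Y \<in> A\<close> S'(1) by (meson symE)
    qed
    show "trans r"
    proof (rule transI)
      fix X Y Z assume XYZ: "(X, Y) \<in> r" "(Y, Z) \<in> r"
      then have A: "X \<in> A" "Y \<in> A" "Z \<in> A" using r by auto
      then obtain M N K where "M \<in> m X" "N \<in> m Y" "K \<in> m Z" using m by (metis ex_in_conv)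
      then show "(X, Z) \<in> r"
        using iff XYZ A S'(2) by (meson transE)
    qed
  qed
  have mB: "N \<in> B" if "X \<in> A" "N \<in> m X" for X N
    using iff[OF that(1,1,2,2)] diagonal[OF that(1)] S by (auto simp: equiv_def)
  \<comment> \<open>Saturating under \<open>S\<close> makes the value independent of the
    representative in \<open>K\<close> and of the choice in its \<open>m\<close>.\<close>
  define \<Phi> where "\<Phi> K = S `` (\<Union>X\<in>K. m X)" for K
  have \<Phi>: "\<Phi> (r `` {X}) = S `` {N}" if X: "X \<in> A" "N \<in> m X" for X N
  proof
    show "\<Phi> (r `` {X}) \<subseteq> S `` {N}"
    proof
      fix K assume "K \<in> \<Phi> (r `` {X})"
      then obtain Y M where "(X, Y) \<in> r" "M \<in> m Y" "(M, K) \<in> S" by (auto simp: \<Phi>_def)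
      moreover then have "(N, M) \<in> S" using iff X r by blast
      ultimately show "K \<in> S `` {N}" using S'(2) by (auto dest: transD)
    qed
    show "S `` {N} \<subseteq> \<Phi> (r `` {X})"
      using X diagonal by (auto simp: \<Phi>_def)
  qed
  have "bij_betw \<Phi> (A // r) (B // S)"
    unfolding bij_betw_def
  proof
    show "inj_on \<Phi> (A // r)"
    proof (rule inj_onI)
      fix K K' assume "K \<in> A // r" "K' \<in> A // r" and eq: "\<Phi> K = \<Phi> K'"
      then obtain X Y where X: "X \<in> A" "K = r `` {X}" and Y: "Y \<in> A" "K' = r `` {Y}"
        by (auto elim!: quotientE)
      obtain M N where MN: "M \<in> m X" "N \<in> m Y" using m X Y by blast
      then have "S `` {M} = S `` {N}" using eq \<Phi> X Y by metis
      then have "(M, N) \<in> S" using eq_equiv_class_iff[OF S] mB MN X(1) Y(1) by metis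
      then have "(X, Y) \<in> r" using iff MN X(1) Y(1) by blast
      then show "K = K'" unfolding X Y by (rule equiv_class_eq[OF r'])
    qed
    show "\<Phi> ` (A // r) = B // S"
    proof
      show "\<Phi> ` (A // r) \<subseteq> B // S"
      proof clarify
        fix K assume "K \<in> A // r"
        then obtain X where X: "X \<in> A" "K = r `` {X}" by (auto elim!: quotientE)
        then obtain N where "N \<in> m X" using m by blast
        then show "\<Phi> K \<in> B // S" using \<Phi> X mB by (metis quotientI)
      qed
      show "B // S \<subseteq> \<Phi> ` (A // r)"
      proof
        fix K assume "K \<in> B // S"
        then obtain M where M: "M \<in> B" "K = S `` {M}" by (auto elim!: quotientE)
        then obtain X N where X: "X \<in> A" "N \<in> m X" "(M, N) \<in> S" using onto by blast
        then have "K = S `` {N}" using M equiv_class_eq[OF S] by metis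
        also have "\<dots> = \<Phi> (r `` {X})" using \<Phi> X by metis
        finally show "K \<in> \<Phi> ` (A // r)" using quotientI[OF X(1)] by blast
      qed
    qed
  qed
  then show ?thesis using r' m \<Phi> by blast
qed

lemma (in irredundant_relation) moduli_space:
  assumes dim: "DIM('v::euclidean_space) = d"
  shows "equiv (type_polytopes R) (projective_rel R :: ('i, 'j, 'v) realization rel) \<and>
    (\<exists>\<Phi>. bij_betw \<Phi>
       (type_polytopes R // (projective_rel R :: ('i, 'j, 'v) realization rel))
       (filled0_matrices R (d + 1) // scaling_rel (filled0_matrices R (d + 1))) \<and>
     (\<forall>X :: ('i, 'j, 'v) realization. X \<in> type_polytopes R \<longrightarrow>
        homogenization_matrices X \<noteq> {} \<and>
        (\<forall>N \<in> homogenization_matrices X.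
           \<Phi> (projective_rel R `` {X}) = scaling_rel (filled0_matrices R (d + 1)) `` {N})))"
proof (rule quotient_bij_of_invariant)
  let ?B = "filled0_matrices R (d + 1)"
  show "projective_rel R \<subseteq> type_polytopes R \<times> (type_polytopes R :: ('i, 'j, 'v) realization set)"
    by (auto simp: projective_rel_def)
  show "equiv ?B (scaling_rel ?B)" by (rule equiv_scaling_rel)
  fix X :: "('i, 'j, 'v) realization" assume X: "X \<in> type_polytopes R"
  show "homogenization_matrices X \<noteq> {}"
    using dim X by (rule homogenization_matrices_nonempty)
  obtain P G v where X_eq: "X = (P, G, v)" by (cases X)
  have "projective_map id = (id :: 'v \<Rightarrow> 'v)" by (auto simp: projective_map_def)
  then show "(X, X) \<in> projective_rel R"
    using X unfolding X_eq projective_rel_def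
    by (auto intro!: exI[of _ id] simp: linear_id)
next
  fix X Y :: "('i, 'j, 'v) realization" and M N
  assume "X \<in> type_polytopes R" "Y \<in> type_polytopes R"
    "M \<in> homogenization_matrices X" "N \<in> homogenization_matrices Y"
  then show "(X, Y) \<in> projective_rel R \<longleftrightarrow>
      (M, N) \<in> scaling_rel (filled0_matrices R (d + 1))"
    using projective_rel_imp_scaling_rel[OF dim] scaling_rel_imp_projective_rel[OF dim] by blast
next
  fix M assume "M \<in> filled0_matrices R (d + 1)"
  then show "\<exists>X\<in>type_polytopes R :: ('i, 'j, 'v) realization set. \<exists>N\<in>homogenization_matrices X.
      (M, N) \<in> scaling_rel (filled0_matrices R (d + 1))"
    using ex_realization[OF dim] by blast
qed

section \<open>From the lattice hypotheses to the theorem\<close>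

lemma diamond_relationI:
  fixes R :: "('i::finite \<times> 'j::finite) set"
  assumes "graded (maxbicliques R) biclique_le"
    and rank: "poset_rank (maxbicliques R) biclique_le = d + 1"
    and "diamond (maxbicliques R) biclique_le" "nondegenerate R"
  shows "diamond_relation R d"
proof
  obtain r where r: "\<And>C. C \<in> flags (maxbicliques R) biclique_le \<Longrightarrow> card C = Suc r"
    using assms(1) by (auto simp: graded_def)
  \<comment> \<open>\<open>poset_rank\<close> is a definite description; the existence of a flag
    makes the length unique.\<close>
  obtain C where C: "C \<in> flags (maxbicliques R) biclique_le"
    using chain_subset_flag[of "maxbicliques R" biclique_le "{}"] by (auto simp: pred_on.chain_def)
  have "poset_rank (maxbicliques R) biclique_le = r"
    unfolding poset_rank_def using r C by (intro the_equality) auto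
  then show "card C = d + 2" if "C \<in> flags (maxbicliques R) biclique_le" for C
    using r[OF that] rank by simp
qed fact+

theorem theorem5:
  fixes R :: "('i::finite \<times> 'j::finite) set" and d :: nat
  assumes "flag_connected (maxbicliques R) biclique_le"
    and "poset_rank (maxbicliques R) biclique_le = d + 1"
    and "diamond (maxbicliques R) biclique_le"
    and "nondegenerate R"
  shows
    "((\<exists>M :: real^'j^'i. filled_incidence 1 R M \<and> rank M = d) \<longleftrightarrow>
      (\<exists>N :: real^'j^'i. filled_incidence 0 R N \<and> rank N = d + 1))
     \<and>
     (irredundant R \<longrightarrow>
      (CARD('n::finite) = d + 1 \<longrightarrow> (\<forall>N :: real^'j^'i.
         (\<exists>(C :: (real^'n) set) F E. type_cone R C F E \<and> facet_ray_matrix C F E N) \<longleftrightarrow>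
         filled_incidence 0 R N \<and> rank N = d + 1))
      \<and>
      equiv (filled0_matrices R (d + 1)) (scaling_rel (filled0_matrices R (d + 1)))
      \<and>
      (CARD('d::finite) = d \<longrightarrow>
         equiv (type_polytopes R) (projective_rel R :: ('i, 'j, real^'d) realization rel) \<and>
         (\<exists>\<Phi>. bij_betw \<Phi>
                 (type_polytopes R // (projective_rel R :: ('i, 'j, real^'d) realization rel))
                 (filled0_matrices R (d + 1) // scaling_rel (filled0_matrices R (d + 1))) \<and>
               (\<forall>X :: ('i, 'j, real^'d) realization. X \<in> type_polytopes R \<longrightarrow>
                  homogenization_matrices X \<noteq> {} \<and>
                  (\<forall>N \<in> homogenization_matrices X.
                     \<Phi> (projective_rel R `` {X}) =
                     scaling_rel (filled0_matrices R (d + 1)) `` {N}))))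
      \<and>
      (d = 0 \<longrightarrow>
         is_singleton
           (filled0_matrices R (d + 1) // scaling_rel (filled0_matrices R (d + 1)))))"
proof -
  have "graded (maxbicliques R) biclique_le" using assms(1) by (simp add: flag_connected_def)
  then interpret diamond_relation R d using assms by (intro diamond_relationI)
  show ?thesis
  proof (intro conjI impI)
    show "(\<exists>M :: real^'j^'i. filled_incidence 1 R M \<and> rank M = d) \<longleftrightarrow>
        (\<exists>N :: real^'j^'i. filled_incidence 0 R N \<and> rank N = d + 1)"
      by (rule filled1_iff_filled0)
    show "equiv (filled0_matrices R (d + 1)) (scaling_rel (filled0_matrices R (d + 1)))"
      by (rule equiv_scaling_rel)
    assume irr: "irredundant R"
    then interpret irredundant_relation R d by unfold_locales
    {
      assume "CARD('n::finite) = d + 1"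
      then have "DIM(real^'n) = d + 1" by simp
      then show "\<forall>N :: real^'j^'i.
          (\<exists>(C :: (real^'n) set) F E. type_cone R C F E \<and> facet_ray_matrix C F E N) \<longleftrightarrow>
          filled_incidence 0 R N \<and> rank N = d + 1"
        using type_cone_facet_ray_matrix_iff by blast
    next
      assume "CARD('d::finite) = d"
      then have dim: "DIM(real^'d) = d" by simp
      show "equiv (type_polytopes R) (projective_rel R :: ('i, 'j, real^'d) realization rel)"
        using moduli_space[OF dim] by (rule conjunct1)
      show "\<exists>\<Phi>. bij_betw \<Phi>
          (type_polytopes R // (projective_rel R :: ('i, 'j, real^'d) realization rel))
          (filled0_matrices R (d + 1) // scaling_rel (filled0_matrices R (d + 1))) \<and>
        (\<forall>X :: ('i, 'j, real^'d) realization. X \<in> type_polytopes R \<longrightarrow>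
          homogenization_matrices X \<noteq> {} \<and>
          (\<forall>N \<in> homogenization_matrices X.
            \<Phi> (projective_rel R `` {X}) = scaling_rel (filled0_matrices R (d + 1)) `` {N}))"
        using moduli_space[OF dim] by (rule conjunct2)
    next
      assume "d = 0"
      then show "is_singleton
          (filled0_matrices R (d + 1) // scaling_rel (filled0_matrices R (d + 1)))"
        by (rule is_singleton_moduli)
    }
  qed
qed

end
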